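(* Let $\Omega_0,\Omega_1,\Omega_0'$, $\mathbf e=(e_1,e_2,e_3)$, $\varphi$, $f$, $g$, $\beta$, $n_1,n_2,n_3$, $\rho_0,\rho_1$ be as in the double-metasurface setup described in the context, and let $$c(x,y)=\sqrt{(g(y)-f(\varphi(x)))^2+|\varphi(x)-y|^2},\qquad (x,y)\in\Omega_0\times\Omega_1.$$ Assume that $\Omega_0,\Omega_1$ are compact, $|\partial\Omega_0|=0$, $c$ is $C^1$ and Lipschitz, the map $y\mapsto\nabla_xc(x,y)$ is injective on $\Omega_1$ for each $x\in\Omega_0$, $\int_{\Omega_0}\rho_0\,dx=\int_{\Omega_1}\rho_1\,dx$, and $\rho_0>0$ a.e. in $\Omega_0$. Let $T:\Omega_0\to\Omega_1$ be the optimal map for the Monge problem with cost $c$ from $\rho_0\,dx$ to $\rho_1\,dx$. Then there is a $c$-concave function $\psi:\Omega_0\to\mathbb R$ with $T=\partial_c\psi$ and $\nabla\psi(x)=\nabla_xc(x,Tx)$ for a.e. $x\in\Omega_0$, such that the phases $\Phi$ (tangential to $S_1$) and $\Psi$ (tangential to $S_2$) solving the double-metasurface problem with the map $T$ satisfy, for a.e. $x\in\Omega_0$, $$(\Phi_{x_1},\Phi_{x_2})=\left(Id-\frac{\nabla f\otimes\nabla f}{1+|\nabla f|^2}\right)\Big(n_2\,\big(J_\varphi(x)^t\big)^{-1}\nabla\psi(x)+n_1e_3(x)\,\nabla f+n_1\,(e_1(x),e_2(x))\Big)$$ and $$(\Psi_{x_1},\Psi_{x_2})=\left(Id-\frac{\nabla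 g\otimes\nabla g}{1+|\nabla g|^2}\right)\left(-n_2\big(J_\varphi(x)^t\big)^{-1}\nabla\psi(x)+n_2\frac{(g(Tx)-f(\varphi(x)))\,(\nabla g(Tx)-\nabla f(\varphi(x)))}{\sqrt{(g(Tx)-f(\varphi(x)))^2+|Tx-\varphi(x)|^2}}-n_3\nabla g\right),$$ where $\Phi_{x_i}$ is evaluated at $(\varphi(x),f(\varphi(x)))$ and $\nabla f$ at $\varphi(x)$, and $\Psi_{x_i}$ is evaluated at $(Tx,g(Tx))$ and $\nabla g$ at $Tx$.
   Context: **Setup (double metasurface).** $\Omega_0,\Omega_1\subset\mathbb R^2$ are planar domains. For each $x=(x_1,x_2)\in\Omega_0$ a unit vector $\mathbf e(x)=(e_1(x),e_2(x),e_3(x))$ with $e_3(x)>0$ is given. $S_1$ is the graph of a strictly positive function $f$. For each $x\in\Omega_0$ the ray $\{(x,0)+t\,\mathbf e(x):t>0\}$ meets $S_1$ at a unique point $(\varphi(x),f(\varphi(x)))$, where $\varphi:\Omega_0\to\Omega_0'$ is a one-to-one $C^2$ map onto a planar domain $\Omega_0'$ with nonsingular Jacobian matrix $J_\varphi=(\partial\varphi_i/\partial x_j)_{i,j=1}^2$, and $f\in C^1(\Omega_0')$. $S_2$ is the graph of a $C^1$ function $g:\Omega_1\to(0,\infty)$, and the distance between $S_1$ and $S_2$ is strictly positive. The plane $z=\beta$ lies above the graph of $g$. The refractive index is $n_1>0$ between $z=0$ and $S_1$, $n_2>0$ between $S_1$ and $S_2$, and $n_3>0$ above $S_2$. $\rho_0,\rho_1$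 are nonnegative integrable densities on $\Omega_0,\Omega_1$. **Phases and the problem.** A phase $\Phi$ on $S_1$ (resp. $\Psi$ on $S_2$) is a $C^1$ function in a neighborhood of $S_1$ (resp. $S_2$) in $\mathbb R^3$, with partial derivatives $\Phi_{x_i}$ (resp. $\Psi_{x_i}$), $i=1,2,3$. It is tangential if $\nabla\Phi(x,f(x))\cdot(-\nabla f(x),1)=0$ for all $x\in\Omega_0'$ (resp. $\nabla\Psi(y,g(y))\cdot(-\nabla g(y),1)=0$ for all $y\in\Omega_1$). Phases $\Phi,\Psi$ solve the double-metasurface problem with the map $T$ if they are tangential, $T$ satisfies $\int_{T^{-1}(E)}\rho_0\,dx=\int_E\rho_1\,dx$ for all Borel $E\subset\Omega_1$, and for a.e. $x\in\Omega_0$ the ray emitted from $(x,0)$ in direction $\mathbf e(x)$ is refracted at $(\varphi(x),f(\varphi(x)))\in S_1$ toward $(Tx,g(Tx))\in S_2$, and there is refracted into the vertical direction $(0,0,1)$, in accordance with the generalized Snell law; that is, with $$\mathbf m(x)=\frac{(Tx-\varphi(x),\,g(Tx)-f(\varphi(x)))}{\sqrt{|Tx-\varphi(x)|^2+(g(Tx)-f(\varphi(x)))^2}},$$ there are $\lambda,\lambda'\in\mathbb R$ (depending on $x$) such that $$n_1\mathbf e(x)-n_2\mathbf m(x)=\lambda\,(-\nabla f(\varphi(x)),1)+\nabla\Phi(\varphi(x),f(\varphi(x))),$$ $$n_2\mathbf m(x)-n_3(0,0,1)=\lambda'\,(-\nabla g(Tx),1)+\nabla\Psi(Tx,g(Tx)).$$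 **Optimal transport.** A function $\psi:\Omega_0\to\mathbb R$ is $c$-concave if for each $x_0\in\Omega_0$ there exist $m_0\in\Omega_1$, $b\in\mathbb R$ with $\psi(x)\le c(x,m_0)-b$ for all $x\in\Omega_0$, with equality at $x=x_0$. Its $c$-transform is $\psi^c(m)=\inf_{x\in\Omega_0}\{c(x,m)-\psi(x)\}$, and $\partial_c\psi(x)=\{m\in\Omega_1:\psi(x)+\psi^c(m)=c(x,m)\}$; $T=\partial_c\psi$ means $\partial_c\psi(x)=\{Tx\}$ for a.e. $x$. The Monge problem is to minimize $\int_{\Omega_0}c(x,s(x))\rho_0(x)\,dx$ over measurable maps $s$ (defined a.e.) from $\Omega_0$ to $\Omega_1$ with $\int_{s^{-1}(E)}\rho_0\,dx=\int_E\rho_1\,dx$ for every Borel $E\subset\Omega_1$; a minimizer is called an optimal map (unique up to null sets). **Notation.** $u\otimes v=uv^t$ for column vectors; $Id$ is the identity matrix; $|\cdot|$ of a set is Lebesgue measure. *)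

theory Defs
  imports "HOL-Analysis.Analysis"
begin

text \<open>
  Points of three-space are written as in \<open>(x, z)\<close> with \<open>x\<close> planar, i.e. R^3 is the Euclidean
  product \<open>real^2 \<times> real\<close>.  Hence \<open>fst\<close> of a vector \<open>(v\<^sub>1, v\<^sub>2, v\<^sub>3)\<close> is \<open>(v\<^sub>1, v\<^sub>2)\<close> and \<open>snd\<close> is \<open>v\<^sub>3\<close>;
  in particular \<open>fst\<close> of the gradient of a phase \<open>\<Phi>\<close> is \<open>(\<Phi>\<^bsub>x1\<^esub>, \<Phi>\<^bsub>x2\<^esub>)\<close>.
\<close>

type_synonym plane = "real ^ 2"
type_synonym space = "(real ^ 2) \<times> real"

text \<open>
  A domain may contain some, all or none of its boundary: the compact domains are the closures
  of bounded nonempty connected open sets.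
\<close>

definition planar_domain :: "plane set \<Rightarrow> bool" where
  "planar_domain D \<longleftrightarrow>
     (\<exists>U. open U \<and> connected U \<and> U \<noteq> {} \<and> U \<subseteq> D \<and> D \<subseteq> closure U)"

text \<open>
  \<open>u\<close> is continuously differentiable on \<open>D\<close> with gradient \<open>Du\<close>.  At boundary points belonging to
  \<open>D\<close> the derivative is taken relative to \<open>D\<close>; if \<open>D\<close> is contained in the closure of its interior,
  continuity makes \<open>Du\<close> unique on \<open>D\<close>.  Restrictions to \<open>D\<close> of functions that are \<open>C\<^sup>1\<close> near \<open>D\<close>
  are included.
\<close>

definition C1_on :: "'a::euclidean_space set \<Rightarrow> ('a \<Rightarrow> real) \<Rightarrow> ('a \<Rightarrow> 'a) \<Rightarrow> bool" where
  "C1_on D u Du \<longleftrightarrow>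
     continuous_on D Du \<and> (\<forall>x\<in>D. (u has_derivative (\<lambda>h. Du x \<bullet> h)) (at x within D))"

text \<open>
  \<open>\<phi>\<close> is \<open>C\<^sup>2\<close> with Jacobian matrix \<open>J\<close>; row \<open>i\<close> of \<open>J\<close> is the gradient of the \<open>i\<close>-th component.
\<close>

definition C2_map_on :: "plane set \<Rightarrow> (plane \<Rightarrow> plane) \<Rightarrow> (plane \<Rightarrow> real ^ 2 ^ 2) \<Rightarrow> bool" where
  "C2_map_on D \<phi> J \<longleftrightarrow>
     (\<forall>i. C1_on D (\<lambda>x. \<phi> x $ i) (\<lambda>x. J x $ i)) \<and>
     (\<forall>i j. \<exists>H. C1_on D (\<lambda>x. J x $ i $ j) H)"

definition graph_over :: "plane set \<Rightarrow> (plane \<Rightarrow> real) \<Rightarrow> space set" where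
  "graph_over D u = (\<lambda>x. (x, u x)) ` D"

definition outer_product :: "real ^ 'n \<Rightarrow> real ^ 'n \<Rightarrow> real ^ 'n ^ 'n" where
  "outer_product u v = (\<chi> i j. u $ i * v $ j)"

definition cost :: "(plane \<Rightarrow> plane) \<Rightarrow> (plane \<Rightarrow> real) \<Rightarrow> (plane \<Rightarrow> real) \<Rightarrow> plane \<Rightarrow> plane \<Rightarrow> real" where
  "cost \<phi> f g x y = sqrt ((g y - f (\<phi> x))\<^sup>2 + (norm (\<phi> x - y))\<^sup>2)"


subsection \<open>Optimal transport\<close>

definition c_concave ::
    "plane set \<Rightarrow> plane set \<Rightarrow> (plane \<Rightarrow> plane \<Rightarrow> real) \<Rightarrow> (plane \<Rightarrow> real) \<Rightarrow> bool" where
  "c_concave \<Omega>\<^sub>0 \<Omega>\<^sub>1 c \<psi> \<longleftrightarrow>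
     (\<forall>x\<^sub>0\<in>\<Omega>\<^sub>0. \<exists>m\<^sub>0\<in>\<Omega>\<^sub>1. \<exists>b. (\<forall>x\<in>\<Omega>\<^sub>0. \<psi> x \<le> c x m\<^sub>0 - b) \<and> \<psi> x\<^sub>0 = c x\<^sub>0 m\<^sub>0 - b)"

definition c_transform ::
    "plane set \<Rightarrow> (plane \<Rightarrow> plane \<Rightarrow> real) \<Rightarrow> (plane \<Rightarrow> real) \<Rightarrow> plane \<Rightarrow> real" where
  "c_transform \<Omega>\<^sub>0 c \<psi> m = (INF x\<in>\<Omega>\<^sub>0. c x m - \<psi> x)"

definition c_superdiff ::
    "plane set \<Rightarrow> plane set \<Rightarrow> (plane \<Rightarrow> plane \<Rightarrow> real) \<Rightarrow> (plane \<Rightarrow> real) \<Rightarrow> plane \<Rightarrow> plane set" where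
  "c_superdiff \<Omega>\<^sub>0 \<Omega>\<^sub>1 c \<psi> x = {m \<in> \<Omega>\<^sub>1. \<psi> x + c_transform \<Omega>\<^sub>0 c \<psi> m = c x m}"

text \<open>
  Maps defined almost everywhere are represented by total functions whose values matter only
  almost everywhere on \<open>\<Omega>\<^sub>0\<close>.
\<close>

definition transport_map ::
    "plane set \<Rightarrow> plane set \<Rightarrow> (plane \<Rightarrow> real) \<Rightarrow> (plane \<Rightarrow> real) \<Rightarrow> (plane \<Rightarrow> plane) \<Rightarrow> bool" where
  "transport_map \<Omega>\<^sub>0 \<Omega>\<^sub>1 \<rho>\<^sub>0 \<rho>\<^sub>1 s \<longleftrightarrow>
     s \<in> borel_measurable (lebesgue_on \<Omega>\<^sub>0) \<and>
     (AE x\<in>\<Omega>\<^sub>0 in lebesgue. s x \<in> \<Omega>\<^sub>1) \<and>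
     (\<forall>E\<in>sets borel. E \<subseteq> \<Omega>\<^sub>1 \<longrightarrow>
        (LINT x:{x \<in> \<Omega>\<^sub>0. s x \<in> E}|lebesgue. \<rho>\<^sub>0 x) = (LINT y:E|lebesgue. \<rho>\<^sub>1 y))"

definition optimal_map ::
    "plane set \<Rightarrow> plane set \<Rightarrow> (plane \<Rightarrow> plane \<Rightarrow> real) \<Rightarrow> (plane \<Rightarrow> real) \<Rightarrow> (plane \<Rightarrow> real) \<Rightarrow>
     (plane \<Rightarrow> plane) \<Rightarrow> bool" where
  "optimal_map \<Omega>\<^sub>0 \<Omega>\<^sub>1 c \<rho>\<^sub>0 \<rho>\<^sub>1 T \<longleftrightarrow>
     transport_map \<Omega>\<^sub>0 \<Omega>\<^sub>1 \<rho>\<^sub>0 \<rho>\<^sub>1 T \<and>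
     (\<forall>s. transport_map \<Omega>\<^sub>0 \<Omega>\<^sub>1 \<rho>\<^sub>0 \<rho>\<^sub>1 s \<longrightarrow>
        (LINT x:\<Omega>\<^sub>0|lebesgue. c x (T x) * \<rho>\<^sub>0 x) \<le> (LINT x:\<Omega>\<^sub>0|lebesgue. c x (s x) * \<rho>\<^sub>0 x))"


subsection \<open>Phases\<close>

definition phase_on :: "space set \<Rightarrow> (space \<Rightarrow> real) \<Rightarrow> (space \<Rightarrow> space) \<Rightarrow> bool" where
  "phase_on S \<Phi> D\<Phi> \<longleftrightarrow> (\<exists>W. open W \<and> S \<subseteq> W \<and> C1_on W \<Phi> D\<Phi>)"

definition tangential ::
    "plane set \<Rightarrow> (plane \<Rightarrow> real) \<Rightarrow> (plane \<Rightarrow> plane) \<Rightarrow> (space \<Rightarrow> space) \<Rightarrow> bool" where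
  "tangential D u Du D\<Phi> \<longleftrightarrow> (\<forall>x\<in>D. D\<Phi> (x, u x) \<bullet> (- Du x, 1) = 0)"

definition refracted_dir ::
    "(plane \<Rightarrow> plane) \<Rightarrow> (plane \<Rightarrow> real) \<Rightarrow> (plane \<Rightarrow> real) \<Rightarrow> (plane \<Rightarrow> plane) \<Rightarrow> plane \<Rightarrow> space" where
  "refracted_dir \<phi> f g T x =
     (1 / sqrt ((norm (T x - \<phi> x))\<^sup>2 + (g (T x) - f (\<phi> x))\<^sup>2)) *\<^sub>R
       (T x - \<phi> x, g (T x) - f (\<phi> x))"

text \<open>
  The two vector equations are the generalized Snell law on the two surfaces, with
  \<open>Df\<close>, \<open>Dg\<close>, \<open>D\<Phi>\<close>, \<open>D\<Psi>\<close> the gradients of \<open>f\<close>, \<open>g\<close>, \<open>\<Phi>\<close>, \<open>\<Psi>\<close>.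
\<close>

definition solves_double_metasurface ::
    "plane set \<Rightarrow> plane set \<Rightarrow> plane set \<Rightarrow> (plane \<Rightarrow> space) \<Rightarrow> (plane \<Rightarrow> plane) \<Rightarrow>
     (plane \<Rightarrow> real) \<Rightarrow> (plane \<Rightarrow> plane) \<Rightarrow> (plane \<Rightarrow> real) \<Rightarrow> (plane \<Rightarrow> plane) \<Rightarrow>
     real \<Rightarrow> real \<Rightarrow> real \<Rightarrow> (plane \<Rightarrow> real) \<Rightarrow> (plane \<Rightarrow> real) \<Rightarrow> (plane \<Rightarrow> plane) \<Rightarrow>
     (space \<Rightarrow> real) \<Rightarrow> (space \<Rightarrow> space) \<Rightarrow> (space \<Rightarrow> real) \<Rightarrow> (space \<Rightarrow> space) \<Rightarrow> bool" where
  "solves_double_metasurface \<Omega>\<^sub>0 \<Omega>\<^sub>0' \<Omega>\<^sub>1 e \<phi> f Df g Dg n\<^sub>1 n\<^sub>2 n\<^sub>3 \<rho>\<^sub>0 \<rho>\<^sub>1 T \<Phi> D\<Phi> \<Psi> D\<Psi> \<longleftrightarrow>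
     phase_on (graph_over \<Omega>\<^sub>0' f) \<Phi> D\<Phi> \<and> tangential \<Omega>\<^sub>0' f Df D\<Phi> \<and>
     phase_on (graph_over \<Omega>\<^sub>1 g) \<Psi> D\<Psi> \<and> tangential \<Omega>\<^sub>1 g Dg D\<Psi> \<and>
     transport_map \<Omega>\<^sub>0 \<Omega>\<^sub>1 \<rho>\<^sub>0 \<rho>\<^sub>1 T \<and>
     (AE x\<in>\<Omega>\<^sub>0 in lebesgue. \<exists>l l'.
        n\<^sub>1 *\<^sub>R e x - n\<^sub>2 *\<^sub>R refracted_dir \<phi> f g T x
          = l *\<^sub>R (- Df (\<phi> x), 1) + D\<Phi> (\<phi> x, f (\<phi> x)) \<and>
        n\<^sub>2 *\<^sub>R refracted_dir \<phi> f g T x - n\<^sub>3 *\<^sub>R (0, 1)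
          = l' *\<^sub>R (- Dg (T x), 1) + D\<Psi> (T x, g (T x)))"

end

theory Submission
  imports Defs "HOL-Complex_Analysis.Great_Picard"
begin

text \<open>
  The optimal map is compared with a maximizer \<open>u\<close> of the Kantorovich dual functional; the potential
  is \<open>\<psi> x = inf\<^sub>y (c(x,y) - u y)\<close>.  Call \<open>y\<close> a contact point of \<open>x\<close> if it attains this infimum.
  Two different contact points of \<open>x\<close> have different gradients \<open>\<nabla>\<^sub>x c(x,y)\<close> by the twist condition, so
  on some coordinate line through \<open>x\<close> the one-sided derivatives of \<open>\<psi>\<close> differ.  On each line this
  happens only countably often, hence almost every \<open>x\<close> has a single contact point \<open>S x\<close>, where \<open>\<psi>\<close>
  is differentiable with gradient \<open>\<nabla>\<^sub>x c(x,S x)\<close>.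
  The first variation of the dual functional at \<open>u\<close> shows that \<open>S\<close> transports \<open>\<rho>\<^sub>0\<close> to \<open>\<rho>\<^sub>1\<close>.  The cost
  of \<open>S\<close> is the dual optimum, so an optimal \<open>T\<close> also takes its values in the contact sets, i.e.
  \<open>T = S\<close> almost everywhere.  The phase formulas then follow from Snell's law: the normal component is
  eliminated by tangentiality, \<open>J\<^sub>\<phi>\<^sup>t\<close> enters through the chain rule for \<open>\<nabla>\<^sub>x c\<close>, and
  \<open>Id + v \<otimes> v\<close> is inverted by \<open>Id - v \<otimes> v / (1 + |v|\<^sup>2)\<close>.
\<close>

subsection \<open>Cost transforms on compact sets\<close>

locale compact_cost =
  fixes X Y :: "plane set" and c :: "plane \<Rightarrow> plane \<Rightarrow> real"
  assumes X: "compact X" "X \<noteq> {}"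
    and Y: "compact Y" "Y \<noteq> {}"
    and cont: "continuous_on (X \<times> Y) (\<lambda>(x, y). c x y)"
begin

text \<open>The hypotheses are symmetric in the two factors, so facts about transforms of functions
  on \<open>X\<close> carry over to transforms of functions on \<open>Y\<close>.\<close>

lemma flip: "compact_cost Y X (\<lambda>y x. c x y)"
proof
  have "continuous_on (Y \<times> X) ((\<lambda>(x, y). c x y) \<circ> (\<lambda>(y, x). (x, y)))"
    by (rule continuous_on_compose) (auto simp: case_prod_unfold intro!: continuous_intros
        continuous_on_subset[OF cont[unfolded case_prod_unfold]])
  then show "continuous_on (Y \<times> X) (\<lambda>(y, x). c x y)"
    by (simp add: comp_def case_prod_unfold)
qed (use X Y in auto)

section \<open>Attainment and continuity of transforms\<close>

lemma cont_fst: "y \<in> Y \<Longrightarrow> continuous_on X (\<lambda>x. c x y)"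
  by (rule continuous_on_compose2[OF cont, of X "\<lambda>x. (x, y)", simplified])
    (auto intro!: continuous_intros)

lemma cont_snd: "x \<in> X \<Longrightarrow> continuous_on Y (\<lambda>y. c x y)"
  by (rule continuous_on_compose2[OF cont, of Y "\<lambda>y. (x, y)", simplified])
    (auto intro!: continuous_intros)

lemma cost_bounded: "\<exists>B. \<forall>x\<in>X. \<forall>y\<in>Y. \<bar>c x y\<bar> \<le> B"
proof -
  have "bounded ((\<lambda>(x, y). c x y) ` (X \<times> Y))"
    by (intro compact_imp_bounded compact_continuous_image cont compact_Times X Y)
  then show ?thesis by (auto simp: bounded_iff)
qed

text \<open>Uniform continuity on the compact product gives one \<open>d\<close> for all
  \<open>y\<close>. This uniformity survives taking an infimum, and also evaluation at points
  \<open>y\<close> that move with \<open>x\<close>.\<close>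

lemma cost_equicontinuous:
  assumes "0 < e"
  obtains d where "d > 0"
    "\<And>x x' y. \<lbrakk>x \<in> X; x' \<in> X; y \<in> Y; dist x x' < d\<rbrakk> \<Longrightarrow> \<bar>c x y - c x' y\<bar> < e"
proof -
  have "uniformly_continuous_on (X \<times> Y) (\<lambda>(x, y). c x y)"
    by (intro compact_uniformly_continuous cont compact_Times X Y)
  with assms obtain d where "d > 0"
    and d: "\<And>p q. \<lbrakk>p \<in> X \<times> Y; q \<in> X \<times> Y; dist q p < d\<rbrakk>
              \<Longrightarrow> dist ((\<lambda>(x, y). c x y) q) ((\<lambda>(x, y). c x y) p) < e"
    unfolding uniformly_continuous_on_def by meson
  show ?thesis
  proof (rule that[OF \<open>d > 0\<close>])
    fix x x' y assume "x \<in> X" "x' \<in> X" "y \<in> Y" "dist x x' < d"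
    then show "\<bar>c x y - c x' y\<bar> < e"
      using d[of "(x', y)" "(x, y)"] by (simp add: dist_Pair_Pair dist_real_def)
  qed
qed

lemma transform_attained:
  assumes "continuous_on X u" "y \<in> Y"
  shows "\<exists>x\<in>X. c_transform X c u y = c x y - u x"
    and transform_le: "x \<in> X \<Longrightarrow> c_transform X c u y \<le> c x y - u x"
proof -
  have *: "continuous_on X (\<lambda>x. c x y - u x)"
    by (intro continuous_intros cont_fst assms)
  obtain z where z: "z \<in> X" "\<And>x. x \<in> X \<Longrightarrow> c z y - u z \<le> c x y - u x"
    using continuous_attains_inf[OF X *] by blast
  then have "c_transform X c u y = c z y - u z"
    unfolding c_transform_def
    by (intro cInf_eq_minimum) auto
  with z show "\<exists>x\<in>X. c_transform X c u y = c x y - u x"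
    and "x \<in> X \<Longrightarrow> c_transform X c u y \<le> c x y - u x" by auto
qed

text \<open>Testing each infimum with the minimizer of the other cancels the values of
  \<open>u\<close>, so only the oscillation of the cost enters. All transforms therefore share one
  modulus of continuity.\<close>

lemma transform_diff_le:
  assumes u: "continuous_on X u" and y: "y \<in> Y" "y' \<in> Y"
    and e: "\<And>x. x \<in> X \<Longrightarrow> \<bar>c x y - c x y'\<bar> \<le> e"
  shows "\<bar>c_transform X c u y - c_transform X c u y'\<bar> \<le> e"
proof -
  obtain x where x: "x \<in> X" "c_transform X c u y = c x y - u x"
    using transform_attained[OF u y(1)] by blast
  obtain x' where x': "x' \<in> X" "c_transform X c u y' = c x' y' - u x'"
    using transform_attained[OF u y(2)] by blast
  show ?thesis
    using e[OF x(1)] e[OF x'(1)] transform_le[OF u y(2) x(1)] transform_le[OF u y(1) x'(1)] x x'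
    by linarith
qed

lemma transform_contraction:
  assumes u: "continuous_on X u" and v: "continuous_on X v" and y: "y \<in> Y"
    and e: "\<And>x. x \<in> X \<Longrightarrow> \<bar>u x - v x\<bar> \<le> e"
  shows "\<bar>c_transform X c u y - c_transform X c v y\<bar> \<le> e"
proof -
  obtain x where x: "x \<in> X" "c_transform X c u y = c x y - u x"
    using transform_attained[OF u y] by blast
  obtain x' where x': "x' \<in> X" "c_transform X c v y = c x' y - v x'"
    using transform_attained[OF v y] by blast
  show ?thesis
    using e[OF x(1)] e[OF x'(1)] transform_le[OF u y x'(1)] transform_le[OF v y x(1)] x x'
    by linarith
qed

lemma transform_mono:
  assumes u: "continuous_on X u" and v: "continuous_on X v" and y: "y \<in> Y"
    and le: "\<And>x. x \<in> X \<Longrightarrow> u x \<le> v x"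
  shows "c_transform X c v y \<le> c_transform X c u y"
proof -
  obtain x where x: "x \<in> X" "c_transform X c u y = c x y - u x"
    using transform_attained[OF u y] by blast
  show ?thesis
    using le[OF x(1)] transform_le[OF v y x(1)] x by linarith
qed

lemma transform_diff_const:
  assumes u: "continuous_on X u" and y: "y \<in> Y"
  shows "c_transform X c (\<lambda>x. u x - k) y = c_transform X c u y + k"
proof -
  have u': "continuous_on X (\<lambda>x. u x - k)"
    by (intro continuous_intros u)
  obtain x where x: "x \<in> X" "c_transform X c u y = c x y - u x"
    using transform_attained[OF u y] by blast
  obtain x' where x': "x' \<in> X" "c_transform X c (\<lambda>x. u x - k) y = c x' y - (u x' - k)"
    using transform_attained[OF u' y] by blast
  show ?thesis
    using transform_le[OF u y x'(1)] transform_le[OF u' y x(1)] x x'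
    by linarith
qed

lemma transform_continuous:
  assumes u: "continuous_on X u"
  shows "continuous_on Y (c_transform X c u)"
proof (rule continuous_onI)
  interpret flip: compact_cost Y X "\<lambda>y x. c x y" by (rule flip)
  fix y :: plane and e :: real assume "y \<in> Y" and e: "0 < e"
  obtain d where d: "d > 0"
    "\<And>y y' x. \<lbrakk>y \<in> Y; y' \<in> Y; x \<in> X; dist y y' < d\<rbrakk> \<Longrightarrow> \<bar>c x y - c x y'\<bar> < e"
    using flip.cost_equicontinuous[OF e] by metis
  have "dist (c_transform X c u y') (c_transform X c u y) \<le> e"
    if "y' \<in> Y" "dist y' y < d" for y'
    unfolding dist_real_def
    by (rule transform_diff_le[OF u]) (use that \<open>y \<in> Y\<close> d(2)[of y' y] in \<open>auto intro: less_imp_le\<close>)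
  then show "\<exists>d>0. \<forall>x'\<in>Y. dist x' y < d \<longrightarrow> dist (c_transform X c u x') (c_transform X c u y) \<le> e"
    using d(1) by blast
qed

text \<open>The transform in the reverse direction, from functions on \<open>Y\<close> to functions
  on \<open>X\<close>. As an input abbreviation it stays an instance of \<open>c_transform\<close>,
  so the facts obtained through \<open>flip\<close> apply verbatim.\<close>

abbreviation (input) conj_fun :: "(plane \<Rightarrow> real) \<Rightarrow> plane \<Rightarrow> real" where
  "conj_fun \<equiv> c_transform Y (\<lambda>y x. c x y)"

lemma conj_fun_continuous: "continuous_on Y u \<Longrightarrow> continuous_on X (conj_fun u)"
  by (rule compact_cost.transform_continuous[OF flip])

lemma conj_fun_attained: "continuous_on Y u \<Longrightarrow> x \<in> X \<Longrightarrow> \<exists>y\<in>Y. conj_fun u x = c x y - u y"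
  by (rule compact_cost.transform_attained[OF flip])

lemma conj_fun_le: "continuous_on Y u \<Longrightarrow> x \<in> X \<Longrightarrow> y \<in> Y \<Longrightarrow> conj_fun u x \<le> c x y - u y"
  by (rule compact_cost.transform_le[OF flip])

section \<open>Composition of the two transforms\<close>

lemma le_double_transform:
  assumes u: "continuous_on Y u" and y: "y \<in> Y"
  shows "u y \<le> c_transform X c (conj_fun u) y"
  using transform_attained[OF conj_fun_continuous[OF u] y] conj_fun_le[OF u _ y] by force

text \<open>The two transforms form an order-reversing Galois connection: one inequality applies the
  antitone transform to \<open>le_double_transform\<close>, the other is
  \<open>le_double_transform\<close> for \<open>conj_fun u\<close> with the roles of
  \<open>X\<close> and \<open>Y\<close> exchanged.\<close>

lemma triple_transform:
  assumes u: "continuous_on Y u" and x: "x \<in> X"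
  shows "conj_fun (c_transform X c (conj_fun u)) x = conj_fun u x"
proof (rule antisym)
  note cu = conj_fun_continuous[OF u]
  show "conj_fun (c_transform X c (conj_fun u)) x \<le> conj_fun u x"
    by (rule compact_cost.transform_mono[OF flip u transform_continuous[OF cu] x])
      (rule le_double_transform[OF u])
  show "conj_fun u x \<le> conj_fun (c_transform X c (conj_fun u)) x"
    by (rule compact_cost.le_double_transform[OF flip cu x])
qed

lemma c_concave_conj_fun:
  assumes u: "continuous_on Y u"
  shows "c_concave X Y c (conj_fun u)"
  unfolding c_concave_def using conj_fun_attained[OF u] conj_fun_le[OF u] by metis

end

subsection \<open>The dual problem\<close>

text \<open>Preimages of Borel sets under a transport map are only Lebesgue measurable. Hence
  \<open>M\<close> may carry more than the Borel sets of \<open>X\<close>, whereas \<open>N\<close>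
  carries exactly those of \<open>Y\<close>.\<close>

locale transport_problem = compact_cost + finite_measure M + N: finite_measure N
  for M N :: "plane measure" +
  assumes sets_M: "sets (restrict_space borel X) \<subseteq> sets M" "space M = X"
    and sets_N: "sets N = sets (restrict_space borel Y)"
    and mass: "measure M X = measure N Y"
begin

section \<open>Integrability of continuous functions\<close>

lemma space_N: "space N = Y"
  using sets_eq_imp_space_eq[OF sets_N] by (simp add: space_restrict_space)

lemma measurable_N: "continuous_on Y (u :: plane \<Rightarrow> real) \<Longrightarrow> u \<in> borel_measurable N"
  using borel_measurable_continuous_on_restrict[of Y u] measurable_cong_sets[OF sets_N refl] by blast

lemma measurable_M:
  assumes "continuous_on X (u :: plane \<Rightarrow> real)" shows "u \<in> borel_measurable M"
proof -
  have u: "u \<in> borel_measurable (restrict_space borel X)"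
    using borel_measurable_continuous_on_restrict[OF assms] .
  show ?thesis
    using measurable_sets[OF u] sets_M(1) unfolding measurable_def
    by (auto simp: space_restrict_space sets_M(2))
qed

lemma integrable_N:
  assumes "continuous_on Y (u :: plane \<Rightarrow> real)" shows "integrable N u"
proof -
  have "bounded (u ` Y)"
    by (intro compact_imp_bounded compact_continuous_image assms Y)
  then obtain B where "\<And>x. x \<in> Y \<Longrightarrow> norm (u x) \<le> B" by (auto simp: bounded_iff)
  then show ?thesis
    by (intro N.integrable_const_bound[of _ B] AE_I2 measurable_N assms) (auto simp: space_N)
qed

lemma integrable_M:
  assumes "continuous_on X (u :: plane \<Rightarrow> real)" shows "integrable M u"
proof -
  have "bounded (u ` X)"
    by (intro compact_imp_bounded compact_continuous_image assms X)
  then obtain B where "\<And>x. x \<in> X \<Longrightarrow> norm (u x) \<le> B" by (auto simp: bounded_iff)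
  then show ?thesis
    by (intro integrable_const_bound[of _ B] AE_I2 measurable_M assms) (auto simp: sets_M)
qed

text \<open>The Kantorovich dual functional with one potential eliminated: on \<open>X\<close>,
  \<open>conj_fun u\<close> is the largest \<open>\<psi>\<close> satisfying
  \<open>\<psi> x + u y \<le> c x y\<close> for all \<open>y\<close> in \<open>Y\<close>.\<close>

definition dual_value :: "(plane \<Rightarrow> real) \<Rightarrow> real" where
  "dual_value u = (\<integral>x. conj_fun u x \<partial>M) + (\<integral>y. u y \<partial>N)"

text \<open>Each of the two integrals changes by at most \<open>e\<close> times the common mass, the
  first one because the transform is a contraction in the supremum norm.\<close>

lemma dual_value_close:
  assumes u: "continuous_on Y u" and v: "continuous_on Y v"
    and e: "\<And>y. y \<in> Y \<Longrightarrow> \<bar>u y - v y\<bar> \<le> e"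
  shows "\<bar>dual_value u - dual_value v\<bar> \<le> 2 * e * measure M X"
proof -
  note cu = conj_fun_continuous[OF u] and cv = conj_fun_continuous[OF v]
  have "\<bar>\<integral>x. conj_fun u x - conj_fun v x \<partial>M\<bar> \<le> (\<integral>x. e \<partial>M)"
    using compact_cost.transform_contraction[OF flip u v _ e]
    by (intro order.trans[OF integral_abs_bound] integral_mono integrable_M continuous_intros cu cv)
      (auto simp: sets_M)
  moreover have "\<bar>\<integral>y. u y - v y \<partial>N\<bar> \<le> (\<integral>y. e \<partial>N)"
    using e
    by (intro order.trans[OF integral_abs_bound] integral_mono integrable_N continuous_intros u v)
      (auto simp: space_N)
  moreover have "dual_value u - dual_value v
      = (\<integral>x. conj_fun u x - conj_fun v x \<partial>M) + (\<integral>y. u y - v y \<partial>N)"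
    using integrable_M[OF cu] integrable_M[OF cv] integrable_N[OF u] integrable_N[OF v]
    by (simp add: dual_value_def)
  moreover have "(\<integral>x. e \<partial>M) = e * measure M X" "(\<integral>y. e \<partial>N) = e * measure M X"
    by (simp_all add: sets_M space_N mass)
  ultimately show ?thesis by linarith
qed

lemma dual_value_double_transform:
  assumes u: "continuous_on Y u"
  shows "dual_value u \<le> dual_value (c_transform X c (conj_fun u))"
proof -
  let ?v = "c_transform X c (conj_fun u)"
  note v = transform_continuous[OF conj_fun_continuous[OF u]]
  have "(\<integral>x. conj_fun ?v x \<partial>M) = (\<integral>x. conj_fun u x \<partial>M)"
    by (intro Bochner_Integration.integral_cong refl triple_transform u) (simp add: sets_M)
  moreover have "(\<integral>y. u y \<partial>N) \<le> (\<integral>y. ?v y \<partial>N)"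
    by (intro integral_mono integrable_N u v le_double_transform) (simp add: space_N)
  ultimately show ?thesis by (simp add: dual_value_def)
qed

text \<open>The transform gains the constant that \<open>u\<close> loses, and the equal masses make
  both contributions cancel. This permits normalizing potentials at one point.\<close>

lemma dual_value_diff_const:
  assumes u: "continuous_on Y u"
  shows "dual_value (\<lambda>y. u y - k) = dual_value u"
proof -
  have "(\<integral>x. conj_fun (\<lambda>y. u y - k) x \<partial>M) = (\<integral>x. conj_fun u x + k \<partial>M)"
    by (intro Bochner_Integration.integral_cong refl compact_cost.transform_diff_const[OF flip u])
      (simp add: sets_M)
  then show ?thesis
    using integrable_M[OF conj_fun_continuous[OF u]] integrable_N[OF u]
    by (simp add: dual_value_def sets_M space_N mass)
qed

text \<open>Double transforms inherit the modulus of continuity of the cost, so that after normalizing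
  them at one point a maximizing sequence is precompact by Arzela-Ascoli.\<close>

theorem dual_maximizer:
  obtains u where "continuous_on Y u"
    "\<And>w. continuous_on Y w \<Longrightarrow> dual_value w \<le> dual_value u"
    "\<And>y. y \<in> Y \<Longrightarrow> c_transform X c (conj_fun u) y = u y"
proof -
  obtain y0 where y0: "y0 \<in> Y" using Y by blast
  obtain B where B: "\<And>x y. x \<in> X \<Longrightarrow> y \<in> Y \<Longrightarrow> \<bar>c x y\<bar> \<le> B"
    using cost_bounded by blast
  \<comment> \<open>Membership in \<open>K\<close> asks for the oscillation bound that every
    transform on \<open>Y\<close> satisfies, and for the normalization at \<open>y0\<close>. These
    two conditions already give equicontinuity and a uniform bound.\<close>
  define K where "K = {w. (\<forall>y\<in>Y. \<forall>y'\<in>Y. \<forall>e. (\<forall>x\<in>X. \<bar>c x y - c x y'\<bar> \<le> e) \<longrightarrow> \<bar>w y - w y'\<bar> \<le> e)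
    \<and> w y0 = 0}"
  have equi: "\<exists>d>0. \<forall>w\<in>K. \<forall>y\<in>Y. \<forall>y'\<in>Y. dist y y' < d \<longrightarrow> \<bar>w y - w y'\<bar> < e" if e: "0 < e" for e
  proof -
    obtain d where "d > 0" and d:
      "\<And>y y' x. \<lbrakk>y \<in> Y; y' \<in> Y; x \<in> X; dist y y' < d\<rbrakk> \<Longrightarrow> \<bar>c x y - c x y'\<bar> < e / 2"
      using compact_cost.cost_equicontinuous[OF flip half_gt_zero[OF e]] by metis
    have "\<bar>w y - w y'\<bar> < e" if "w \<in> K" "y \<in> Y" "y' \<in> Y" "dist y y' < d" for w y y'
    proof -
      have "\<forall>x\<in>X. \<bar>c x y - c x y'\<bar> \<le> e / 2" using d that by (auto intro: less_imp_le)
      then have "\<bar>w y - w y'\<bar> \<le> e / 2" using that(1-3) unfolding K_def by blast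
      then show ?thesis using e by linarith
    qed
    then show ?thesis using \<open>d > 0\<close> by blast
  qed
  have Kcont: "continuous_on Y w" if "w \<in> K" for w
    unfolding continuous_on_iff dist_real_def
    using equi that by (metis dist_commute)
  have Kbound: "\<bar>w y\<bar> \<le> 2 * B" if "w \<in> K" "y \<in> Y" for w y
  proof -
    have "\<bar>c x y - c x y0\<bar> \<le> 2 * B" if "x \<in> X" for x
      using B[OF that \<open>y \<in> Y\<close>] B[OF that y0] by linarith
    then have "\<bar>w y - w y0\<bar> \<le> 2 * B" using that y0 unfolding K_def by blast
    then show ?thesis using that by (simp add: K_def)
  qed
  \<comment> \<open>Restricting the supremum to \<open>K\<close> loses nothing: the normalized
    double transform of \<open>w\<close> lies in \<open>K\<close> and has at least the dual value of
    \<open>w\<close>.\<close>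
  have K: "\<exists>w'\<in>K. dual_value w \<le> dual_value w'" if w: "continuous_on Y w" for w
  proof -
    let ?v = "c_transform X c (conj_fun w)"
    note cw = conj_fun_continuous[OF w]
    have "(\<lambda>y. ?v y - ?v y0) \<in> K"
      using transform_diff_le[OF cw] by (auto simp: K_def)
    moreover have "dual_value w \<le> dual_value (\<lambda>y. ?v y - ?v y0)"
      using dual_value_double_transform[OF w] dual_value_diff_const[OF transform_continuous[OF cw]]
      by simp
    ultimately show ?thesis by blast
  qed
  have "(\<lambda>y. 0) \<in> K" unfolding K_def using X(2) by fastforce
  have bdd: "bdd_above (dual_value ` K)"
  proof (rule bdd_aboveI2)
    fix w assume "w \<in> K"
    then show "dual_value w \<le> dual_value (\<lambda>y. 0) + 2 * (2 * B) * measure M X"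
      using dual_value_close[of w "\<lambda>y. 0" "2 * B"] Kbound Kcont by force
  qed
  define s where "s = Sup (dual_value ` K)"
  have "\<exists>w\<in>K. s - 1 / Suc n < dual_value w" for n
    using less_cSUP_iff[OF _ bdd, of "s - 1 / Suc n"] \<open>(\<lambda>y. 0) \<in> K\<close>
    by (auto simp: s_def)
  then obtain w where w: "\<And>n. w n \<in> K" "\<And>n. s - 1 / Suc n < dual_value (w n)" by metis
  obtain g and k :: "nat \<Rightarrow> nat" where g: "continuous_on Y g" and k: "strict_mono k"
    and conv: "\<And>e. 0 < e \<Longrightarrow> \<exists>N. \<forall>n x. n \<ge> N \<and> x \<in> Y \<longrightarrow> norm (w (k n) x - g x) < e"
  proof (rule Arzela_Ascoli[of Y w "2 * B"])
    show "norm (w n x) \<le> 2 * B" if "x \<in> Y" for n x using Kbound[OF w(1) that] by simp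
    show "\<exists>d>0. \<forall>n y. y \<in> Y \<and> norm (x - y) < d \<longrightarrow> norm (w n x - w n y) < e"
      if "x \<in> Y" "0 < e" for x e
    proof -
      obtain d where "d > 0" "\<forall>w\<in>K. \<forall>y\<in>Y. \<forall>y'\<in>Y. dist y y' < d \<longrightarrow> \<bar>w y - w y'\<bar> < e"
        using equi[OF \<open>0 < e\<close>] by blast
      then show ?thesis
        using w(1) that(1) by (intro exI[of _ d]) (simp add: dist_norm)
    qed
  qed (use Y(1) that in blast)+
  have "s \<le> dual_value g + e" if e: "0 < e" for e
  proof -
    \<comment> \<open>Chosen so that the error \<open>2 * e' * measure M X\<close> is at most
      \<open>e / 2\<close>; adding 1 to the mass avoids division by zero.\<close>
    define e' where "e' = e / (4 * (measure M X + 1))"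
    have pos: "0 < measure M X + 1" by (simp add: add_nonneg_pos)
    with that have "0 < e'" by (simp add: e'_def)
    moreover have "2 * e' * (measure M X + 1) = e / 2"
      using pos by (simp add: e'_def field_simps)
    ultimately have e': "2 * e' * measure M X \<le> e / 2" by (simp add: distrib_left)
    obtain m where m: "\<And>n x. n \<ge> m \<Longrightarrow> x \<in> Y \<Longrightarrow> \<bar>w (k n) x - g x\<bar> < e'"
      using conv[OF \<open>0 < e'\<close>] by auto
    obtain l where l: "1 / Suc l < e / 2"
      by (rule nat_approx_posE[of "e / 2"]) (use e that in auto)
    let ?n = "max m l"
    have "\<bar>dual_value (w (k ?n)) - dual_value g\<bar> \<le> 2 * e' * measure M X"
      by (rule dual_value_close) (use Kcont w g m[of ?n] in \<open>auto intro: less_imp_le\<close>)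
    moreover have "1 / Suc (k ?n) \<le> 1 / Suc l"
      using seq_suble[OF k, of ?n] by (intro divide_left_mono) auto
    ultimately show ?thesis using w(2)[of "k ?n"] l e' by linarith
  qed
  then have s: "s \<le> dual_value g" by (rule field_le_epsilon)
  \<comment> \<open>The limit \<open>g\<close> is replaced by its double transform: the dual value
    does not decrease, and the result equals its own double transform.\<close>
  let ?u = "c_transform X c (conj_fun g)"
  show ?thesis
  proof (rule that)
    show "continuous_on Y ?u" by (rule transform_continuous[OF conj_fun_continuous[OF g]])
    fix v :: "plane \<Rightarrow> real" assume v: "continuous_on Y v"
    then obtain w' where "w' \<in> K" "dual_value v \<le> dual_value w'" using K by blast
    then have "dual_value v \<le> s" using bdd by (auto simp: s_def intro: cSUP_upper2)
    with s dual_value_double_transform[OF g] show "dual_value v \<le> dual_value ?u" by linarith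
  next
    fix y assume "y \<in> Y"
    then show "c_transform X c (conj_fun ?u) y = ?u y"
      using compact_cost.triple_transform[OF flip conj_fun_continuous[OF g]] by simp
  qed
qed

end

subsection \<open>Uniqueness of contact points\<close>

text \<open>By Tonelli, averaging the translates of \<open>A\<close> along \<open>b\<close> gives both \<open>0\<close> and the measure of \<open>A\<close>.\<close>

lemma negligible_if_countable_lines:
  fixes A :: "'a::euclidean_space set" and b :: 'a
  assumes A: "A \<in> sets borel" and lines: "\<And>x. countable {t. x + t *\<^sub>R b \<in> A}"
  shows "negligible A"
proof -
  have [measurable]: "A \<in> sets lborel" using A by simp
  have 0: "(\<integral>\<^sup>+ t. indicator {0..1} t * indicator A (x + t *\<^sub>R b) \<partial>lborel) = 0" for x :: 'a
  proof -
    have "AE t in lborel. t \<notin> {t. x + t *\<^sub>R b \<in> A}"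
      by (intro AE_not_in countable_imp_null_set_lborel lines)
    then show ?thesis
      by (subst nn_integral_0_iff_AE) (auto simp: indicator_def elim: eventually_mono)
  qed
  have shift: "(\<integral>\<^sup>+ x. indicator A (x + t *\<^sub>R b) \<partial>lborel) = emeasure lborel A" for t :: real
  proof -
    have "(\<integral>\<^sup>+ x. indicator A (x + t *\<^sub>R b) \<partial>lborel)
        = (\<integral>\<^sup>+ x. indicator A x \<partial>(distr lborel borel (\<lambda>x. t *\<^sub>R b + x)))"
      by (subst nn_integral_distr) (auto simp: add.commute)
    also have "\<dots> = (\<integral>\<^sup>+ x. indicator A x \<partial>lborel)" by (simp add: lborel_distr_plus)
    also have "\<dots> = emeasure lborel A" by (rule nn_integral_indicator) measurable
    finally show ?thesis .
  qed
  have "0 = (\<integral>\<^sup>+ x. (\<integral>\<^sup>+ t. indicator {0..1} t * indicator A (x + t *\<^sub>R b) \<partial>lborel) \<partial>(lborel :: 'a measure))"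
    unfolding 0 by simp
  also have "\<dots> = (\<integral>\<^sup>+ t. (\<integral>\<^sup>+ x. indicator {0..1} t * indicator A (x + t *\<^sub>R b) \<partial>lborel) \<partial>(lborel :: real measure))"
    by (rule lborel_pair.Fubini') measurable
  also have "\<dots> = (\<integral>\<^sup>+ t. indicator {0..1} t * emeasure lborel A \<partial>(lborel :: real measure))"
    by (simp add: nn_integral_cmult shift)
  also have "\<dots> = emeasure lborel A" by (simp add: nn_integral_multc)
  finally have "emeasure lborel A = 0" by simp
  then show ?thesis
    unfolding negligible_iff_null_sets
    using A by (intro null_sets_completionI null_setsI) simp_all
qed

text \<open>Picking a rational in each interval is injective, since the intervals are pairwise
  disjoint.\<close>

lemma countable_if_disjoint_intervals:
  fixes S :: "real set" and l r :: "real \<Rightarrow> real"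
  assumes "\<And>t. t \<in> S \<Longrightarrow> l t < r t" and "\<And>s t. \<lbrakk>s \<in> S; t \<in> S; s < t\<rbrakk> \<Longrightarrow> r t \<le> l s"
  shows "countable S"
proof -
  have "\<forall>t\<in>S. \<exists>q. l t < real_of_rat q \<and> real_of_rat q < r t"
    using assms(1) of_rat_dense by blast
  then obtain q where q: "\<And>t. t \<in> S \<Longrightarrow> l t < real_of_rat (q t) \<and> real_of_rat (q t) < r t"
    by metis
  have ne: "q s \<noteq> q t" if "s \<in> S" "t \<in> S" "s < t" for s t
  proof
    assume "q s = q t"
    then show False using assms(2)[OF that] q[OF that(1)] q[OF that(2)] by simp
  qed
  have "inj_on q S"
    by (rule linorder_inj_onI) (use ne in auto)
  then show ?thesis by (rule countableI')
qed

text \<open>Outside a ball around \<open>y\<close>, compactness gives a minimum of \<open>F\<close>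
  strictly above \<open>F y\<close>. Values of \<open>F\<close> tending to \<open>F y\<close> thus
  force \<open>f\<close> into the ball.\<close>

lemma tendsto_unique_minimizer:
  fixes F :: "'a::metric_space \<Rightarrow> real"
  assumes Y: "compact Y" and F: "continuous_on Y F"
    and y: "\<And>z. z \<in> Y \<Longrightarrow> z \<noteq> y \<Longrightarrow> F y < F z"
    and f: "\<forall>\<^sub>F i in K. f i \<in> Y" and lim: "((\<lambda>i. F (f i)) \<longlongrightarrow> F y) K"
  shows "(f \<longlongrightarrow> y) K"
proof (rule tendstoI)
  fix e :: real assume "0 < e"
  let ?Z = "Y - ball y e"
  show "\<forall>\<^sub>F i in K. dist (f i) y < e"
  proof (cases "?Z = {}")
    case True
    with f show ?thesis by (auto simp: dist_commute elim!: eventually_mono)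
  next
    case False
    have "compact ?Z" by (intro compact_diff Y open_ball)
    then obtain z where z: "z \<in> ?Z" "\<And>z'. z' \<in> ?Z \<Longrightarrow> F z \<le> F z'"
      using continuous_attains_inf[OF _ False continuous_on_subset[OF F]] by blast
    have "F y < F z" using z(1) \<open>0 < e\<close> by (intro y) auto
    from order_tendstoD(2)[OF lim this] f show ?thesis
    proof eventually_elim
      case (elim i)
      then have "f i \<notin> ?Z" using z(2) by force
      with elim show ?case by (simp add: dist_commute)
    qed
  qed
qed

section \<open>Contact sets and their stability\<close>

context compact_cost
begin

definition contact :: "(plane \<Rightarrow> real) \<Rightarrow> plane \<Rightarrow> plane set" where
  "contact u x = {y\<in>Y. conj_fun u x = c x y - u y}"

lemma contact_nonempty: "continuous_on Y u \<Longrightarrow> x \<in> X \<Longrightarrow> \<exists>y. y \<in> contact u x"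
  using conj_fun_attained by (auto simp: contact_def)

text \<open>The graph is the zero set of a continuous function on a compact product. Its role is
  measurability: projections of its closed pieces are compact, hence Borel.\<close>

lemma compact_contact:
  assumes u: "continuous_on Y u"
  shows "compact {(x, y). x \<in> X \<and> y \<in> contact u x}"
proof -
  have "continuous_on (X \<times> Y) (\<lambda>p. (\<lambda>(x, y). c x y) p - u (snd p) - conj_fun u (fst p))"
    by (intro continuous_intros cont continuous_on_compose2[OF u] continuous_on_compose2[OF conj_fun_continuous[OF u]])
      auto
  then have "closed {p \<in> X \<times> Y. (\<lambda>(x, y). c x y) p - u (snd p) - conj_fun u (fst p) = 0}"
    by (intro continuous_closed_preimage_constant compact_imp_closed compact_Times X Y)
  moreover have "bounded {p \<in> X \<times> Y. (\<lambda>(x, y). c x y) p - u (snd p) - conj_fun u (fst p) = 0}"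
    by (rule bounded_subset[OF compact_imp_bounded[OF compact_Times[OF X(1) Y(1)]]]) auto
  ultimately have "compact {p \<in> X \<times> Y. (\<lambda>(x, y). c x y) p - u (snd p) - conj_fun u (fst p) = 0}"
    using compact_eq_bounded_closed by blast
  also have "{p \<in> X \<times> Y. (\<lambda>(x, y). c x y) p - u (snd p) - conj_fun u (fst p) = 0}
      = {(x, y). x \<in> X \<and> y \<in> contact u x}"
    by (auto simp: contact_def)
  finally show ?thesis .
qed

text \<open>The superdifferential involves the transform of \<open>conj_fun u\<close>, which the
  hypothesis identifies with \<open>u\<close>. The maximizer is chosen as a double transform for
  this purpose.\<close>

lemma c_superdiff_eq_contact:
  assumes "\<And>y. y \<in> Y \<Longrightarrow> c_transform X c (conj_fun u) y = u y"
  shows "c_superdiff X Y c (conj_fun u) x = contact u x"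
  using assms by (auto simp: c_superdiff_def contact_def algebra_simps)

text \<open>A singleton contact set means that \<open>y\<close> is the unique minimizer of the cost
  minus \<open>u\<close>, so asymptotically optimal points converge to it. Both the gradient of the
  potential and the first variation rest on this stability.\<close>

lemma contact_tendsto:
  assumes u: "continuous_on Y u" and x: "x \<in> X" "contact u x = {y}"
    and f: "\<forall>\<^sub>F i in K. f i \<in> Y" and lim: "((\<lambda>i. c x (f i) - u (f i)) \<longlongrightarrow> conj_fun u x) K"
  shows "(f \<longlongrightarrow> y) K"
proof (rule tendsto_unique_minimizer[OF Y(1) _ _ f])
  have y: "y \<in> Y" "conj_fun u x = c x y - u y" using x(2) by (auto simp: contact_def)
  show "continuous_on Y (\<lambda>y. c x y - u y)"
    by (intro continuous_intros cont_snd x u)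
  show "((\<lambda>i. c x (f i) - u (f i)) \<longlongrightarrow> c x y - u y) K" using lim y(2) by simp
  fix z assume "z \<in> Y" "z \<noteq> y"
  then have "z \<notin> contact u x" using x(2) by auto
  then show "c x y - u y < c x z - u z"
    using conj_fun_le[OF u x(1) \<open>z \<in> Y\<close>] \<open>z \<in> Y\<close> y(2) by (auto simp: contact_def)
qed

end

section \<open>Slopes of the cost at contact points\<close>

locale smooth_cost = compact_cost +
  fixes p :: "plane \<Rightarrow> plane \<Rightarrow> plane"
  assumes deriv: "\<And>x y. \<lbrakk>x \<in> X; y \<in> Y\<rbrakk> \<Longrightarrow> ((\<lambda>x. c x y) has_derivative (\<lambda>h. p x y \<bullet> h)) (at x within X)"
    and cont_p: "continuous_on (X \<times> Y) (\<lambda>(x, y). p x y)"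
begin

text \<open>The mean value inequality along the segment, with \<open>p\<close> uniformly continuous
  on the compact product, makes the error uniform in \<open>x\<close> and \<open>y\<close>. The
  segment is required to lie in \<open>X\<close> because \<open>X\<close> may fail to be
  convex.\<close>

lemma uniform_linearization:
  assumes "0 < e"
  obtains d where "d > 0" "\<And>x z y. \<lbrakk>closed_segment x z \<subseteq> X; y \<in> Y; dist x z < d\<rbrakk> \<Longrightarrow>
    \<bar>c z y - c x y - p x y \<bullet> (z - x)\<bar> \<le> e * norm (z - x)"
proof -
  have "uniformly_continuous_on (X \<times> Y) (\<lambda>(x, y). p x y)"
    by (intro compact_uniformly_continuous cont_p compact_Times X Y)
  with assms obtain d where "d > 0"
    and d: "\<And>v w. \<lbrakk>v \<in> X \<times> Y; w \<in> X \<times> Y; dist w v < d\<rbrakk>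
              \<Longrightarrow> dist ((\<lambda>(x, y). p x y) w) ((\<lambda>(x, y). p x y) v) < e"
    unfolding uniformly_continuous_on_def by meson
  show ?thesis
  proof (rule that[OF \<open>d > 0\<close>])
    fix x z y assume seg: "closed_segment x z \<subseteq> X" and y: "y \<in> Y" and "dist x z < d"
    let ?S = "closed_segment x z"
    have "norm (c z y - c x y - p x y \<bullet> (z - x)) \<le> norm (z - x) * e"
    proof (rule differentiable_bound_linearization[of x z ?S "\<lambda>x. c x y" "\<lambda>w h. p w y \<bullet> h" x e])
      show "x + t *\<^sub>R (z - x) \<in> ?S" if "t \<in> {0..1}" for t
        using that by (auto simp: in_segment algebra_simps intro!: exI[of _ t])
      show "((\<lambda>x. c x y) has_derivative (\<lambda>h. p w y \<bullet> h)) (at w within ?S)" if "w \<in> ?S" for w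
        using has_derivative_subset[OF deriv seg] that seg y by blast
      show "onorm ((\<lambda>h. p w y \<bullet> h) - (\<lambda>h. p x y \<bullet> h)) \<le> e" if w: "w \<in> ?S" for w
      proof (rule onorm_le)
        fix h :: plane
        have "dist w x < d"
          using segment_bound[OF w] \<open>dist x z < d\<close> by (simp add: dist_norm norm_minus_commute)
        moreover have "x \<in> X" "w \<in> X" using w seg ends_in_segment[of x z] by auto
        ultimately have "norm (p w y - p x y) \<le> e"
          using d[of "(x, y)" "(w, y)"] y by (simp add: dist_Pair_Pair dist_norm)
        then have "norm (p w y - p x y) * norm h \<le> e * norm h" by (rule mult_right_mono) simp
        with Cauchy_Schwarz_ineq2[of "p w y - p x y" h]
        show "norm (((\<lambda>h. p w y \<bullet> h) - (\<lambda>h. p x y \<bullet> h)) h) \<le> e * norm h"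
          by (simp add: inner_diff_left)
      qed
    qed simp
    then show "\<bar>c z y - c x y - p x y \<bullet> (z - x)\<bar> \<le> e * norm (z - x)" by (simp add: mult.commute)
  qed
qed

text \<open>Testing the contact point of each end at the other end and linearizing at both gives an
  approximate form of the monotonicity of superdifferentials of concave functions: slopes in
  direction \<open>z - x\<close> do not increase from \<open>x\<close> to \<open>z\<close>, up to
  the linearization error.\<close>

lemma contact_gradient_monotone:
  assumes e: "0 < e" and u: "continuous_on Y u"
    and lin: "\<And>x z y. \<lbrakk>closed_segment x z \<subseteq> X; y \<in> Y; dist x z < d\<rbrakk> \<Longrightarrow>
      \<bar>c z y - c x y - p x y \<bullet> (z - x)\<bar> \<le> e * norm (z - x)"
    and seg: "closed_segment x z \<subseteq> X" and d: "dist x z < d"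
    and y: "y \<in> contact u x" and w: "w \<in> contact u z"
  shows "p z w \<bullet> (z - x) \<le> p x y \<bullet> (z - x) + 2 * e * norm (z - x)"
proof -
  have seg': "closed_segment z x \<subseteq> X" using seg by (simp add: closed_segment_commute)
  have xz: "x \<in> X" "z \<in> X" using seg ends_in_segment by blast+
  have yw: "y \<in> Y" "w \<in> Y" "conj_fun u x = c x y - u y" "conj_fun u z = c z w - u w"
    using y w by (auto simp: contact_def)
  have "conj_fun u z - conj_fun u x \<le> c z y - c x y"
    using conj_fun_le[OF u xz(2) yw(1)] yw(3) by linarith
  moreover have "conj_fun u x - conj_fun u z \<le> c x w - c z w"
    using conj_fun_le[OF u xz(1) yw(2)] yw(4) by linarith
  moreover have "\<bar>c z y - c x y - p x y \<bullet> (z - x)\<bar> \<le> e * norm (z - x)"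
    by (rule lin[OF seg yw(1) d])
  moreover have "\<bar>c x w - c z w - p z w \<bullet> (x - z)\<bar> \<le> e * norm (z - x)"
    using lin[OF seg' yw(2)] d by (simp add: dist_commute norm_minus_commute)
  moreover have "p z w \<bullet> (x - z) = - (p z w \<bullet> (z - x))" by (simp add: inner_diff_right)
  ultimately show ?thesis by linarith
qed

text \<open>The non-strict inequality with a fixed gap \<open>r\<close> makes this set compact, and
  a positive \<open>r\<close> leaves room to absorb linearization errors. The gaps
  \<open>1 / Suc n\<close> exhaust all positive differences of slopes.\<close>

definition gap_set :: "(plane \<Rightarrow> real) \<Rightarrow> plane \<Rightarrow> real \<Rightarrow> plane set" where
  "gap_set u b r = {x\<in>X. \<exists>y\<in>contact u x. \<exists>w\<in>contact u x. p x y \<bullet> b \<ge> p x w \<bullet> b + r}"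

text \<open>The set is the projection of a compact set of pairs of contact pairs, cut out by the
  closed conditions that the base points agree and that the slopes differ by at least
  \<open>r\<close>.\<close>

lemma compact_gap_set:
  assumes u: "continuous_on Y u"
  shows "compact (gap_set u b r)"
proof -
  let ?G = "{(x, y). x \<in> X \<and> y \<in> contact u x}"
  let ?f = "\<lambda>q. p (fst (fst q)) (snd (fst q)) \<bullet> b - p (fst (snd q)) (snd (snd q)) \<bullet> b - r"
  have sub: "?G \<subseteq> X \<times> Y" by (auto simp: contact_def)
  have GG: "compact (?G \<times> ?G)" by (intro compact_Times compact_contact u)
  have p1: "continuous_on (X \<times> Y) (\<lambda>q. p (fst q) (snd q))"
    using cont_p by (simp add: case_prod_unfold)
  have "continuous_on (?G \<times> ?G) ?f"
    by (intro continuous_intros continuous_on_compose2[OF p1, of _ fst] continuous_on_compose2[OF p1, of _ snd])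
      (use sub in auto)
  then have "closed (?G \<times> ?G \<inter> ?f -` {0..})"
    by (rule continuous_closed_preimage[OF _ compact_imp_closed[OF GG] closed_atLeast])
  moreover have "closed {q :: (plane \<times> plane) \<times> (plane \<times> plane). fst (fst q) = fst (snd q)}"
    by (intro closed_Collect_eq continuous_intros)
  ultimately have "compact (?G \<times> ?G \<inter> ({q. fst (fst q) = fst (snd q)} \<inter> (?G \<times> ?G \<inter> ?f -` {0..})))"
    by (rule compact_Int_closed[OF GG closed_Int, rotated])
  then have "compact ((\<lambda>q. fst (fst q)) ` (?G \<times> ?G \<inter> ({q. fst (fst q) = fst (snd q)} \<inter> (?G \<times> ?G \<inter> ?f -` {0..}))))"
    by (intro compact_continuous_image continuous_intros)
  also have "\<dots> = gap_set u b r"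
  proof (intro set_eqI iffI)
    fix x assume "x \<in> gap_set u b r"
    then obtain y w where "x \<in> X" "y \<in> contact u x" "w \<in> contact u x" "p x y \<bullet> b \<ge> p x w \<bullet> b + r"
      by (auto simp: gap_set_def)
    then show "x \<in> (\<lambda>q. fst (fst q)) `
        (?G \<times> ?G \<inter> ({q. fst (fst q) = fst (snd q)} \<inter> (?G \<times> ?G \<inter> ?f -` {0..})))"
      by (intro image_eqI[of _ _ "((x, y), (x, w))"]) auto
  next
    fix x assume "x \<in> (\<lambda>q. fst (fst q)) `
        (?G \<times> ?G \<inter> ({q. fst (fst q) = fst (snd q)} \<inter> (?G \<times> ?G \<inter> ?f -` {0..})))"
    then obtain y w where "x \<in> X" "y \<in> contact u x" "w \<in> contact u x" "p x y \<bullet> b \<ge> p x w \<bullet> b + r"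
      by (auto simp: algebra_simps)
    then show "x \<in> gap_set u b r" by (auto simp: gap_set_def)
  qed
  finally show ?thesis .
qed

text \<open>Along a line in direction \<open>b\<close> the intervals spanned by the slopes \<open>p x y \<bullet> b\<close> at the
  contact points are almost ordered decreasingly, so only countably many of them have length
  at least \<open>r\<close>.\<close>

lemma negligible_gap_set:
  assumes u: "continuous_on Y u" and r: "0 < r" and b: "norm b = 1"
  shows "negligible (gap_set u b r \<inter> interior X)"
proof (subst locally_negligible_alt, rule ballI)
  fix x assume x: "x \<in> gap_set u b r \<inter> interior X"
  \<comment> \<open>Monotonicity costs twice this tolerance, that is \<open>r / 2\<close>. Slope
    intervals of length at least \<open>r\<close>, shortened by \<open>r / 2\<close> from below,
    thus stay nonempty and become disjoint.\<close>
  have e: "0 < r / 4" using r by simp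
  obtain d where "d > 0" and lin: "\<And>x z y. \<lbrakk>closed_segment x z \<subseteq> X; y \<in> Y; dist x z < d\<rbrakk> \<Longrightarrow>
      \<bar>c z y - c x y - p x y \<bullet> (z - x)\<bar> \<le> r / 4 * norm (z - x)"
    using uniform_linearization[OF e] by blast
  obtain \<eta> where \<eta>: "\<eta> > 0" "ball x \<eta> \<subseteq> X" using x mem_interior by blast
  \<comment> \<open>The ball is convex and contained in \<open>X\<close>, so segments between its
    points are admissible; the radius bound \<open>d / 2\<close> keeps any two of its points within
    distance \<open>d\<close>.\<close>
  define B where "B = ball x (min \<eta> (d / 2))"
  have BX: "B \<subseteq> interior X"
    using \<eta> unfolding B_def by (intro interior_maximal) auto
  let ?A = "gap_set u b r \<inter> B"
  have "countable {t. z + t *\<^sub>R b \<in> ?A}" for z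
  proof -
    have "\<forall>t\<in>{t. z + t *\<^sub>R b \<in> ?A}. \<exists>y w. y \<in> contact u (z + t *\<^sub>R b) \<and> w \<in> contact u (z + t *\<^sub>R b) \<and>
        p (z + t *\<^sub>R b) y \<bullet> b \<ge> p (z + t *\<^sub>R b) w \<bullet> b + r"
      by (auto simp: gap_set_def)
    then obtain y w where yw: "\<And>t. t \<in> {t. z + t *\<^sub>R b \<in> ?A} \<Longrightarrow> y t \<in> contact u (z + t *\<^sub>R b) \<and>
        w t \<in> contact u (z + t *\<^sub>R b) \<and> p (z + t *\<^sub>R b) (y t) \<bullet> b \<ge> p (z + t *\<^sub>R b) (w t) \<bullet> b + r"
      by metis
    show ?thesis
    proof (rule countable_if_disjoint_intervals[where
        l = "\<lambda>t. p (z + t *\<^sub>R b) (w t) \<bullet> b + r / 2" and r = "\<lambda>t. p (z + t *\<^sub>R b) (y t) \<bullet> b"])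
      fix t assume "t \<in> {t. z + t *\<^sub>R b \<in> ?A}"
      then show "p (z + t *\<^sub>R b) (w t) \<bullet> b + r / 2 < p (z + t *\<^sub>R b) (y t) \<bullet> b"
        using yw[of t] r by auto
    next
      fix s t assume s: "s \<in> {t. z + t *\<^sub>R b \<in> ?A}" and t: "t \<in> {t. z + t *\<^sub>R b \<in> ?A}" and "s < t"
      have inB: "z + s *\<^sub>R b \<in> B" "z + t *\<^sub>R b \<in> B" using s t by auto
      have seg: "closed_segment (z + s *\<^sub>R b) (z + t *\<^sub>R b) \<subseteq> X"
        using closed_segment_subset[OF inB] BX interior_subset unfolding B_def by blast
      have dist: "dist (z + s *\<^sub>R b) (z + t *\<^sub>R b) < d"
        by (rule dist_triangle_half_r[of x]) (use inB in \<open>simp_all add: B_def\<close>)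
      have diff: "(z + t *\<^sub>R b) - (z + s *\<^sub>R b) = (t - s) *\<^sub>R b" by (simp add: algebra_simps)
      have "p (z + t *\<^sub>R b) (y t) \<bullet> ((t - s) *\<^sub>R b)
          \<le> p (z + s *\<^sub>R b) (w s) \<bullet> ((t - s) *\<^sub>R b) + 2 * (r / 4) * norm ((t - s) *\<^sub>R b)"
        using contact_gradient_monotone[OF e u lin seg dist, of "w s" "y t"] yw[OF s] yw[OF t]
        unfolding diff by blast
      moreover have "norm ((t - s) *\<^sub>R b) = t - s" using \<open>s < t\<close> b by simp
      ultimately have "(t - s) * (p (z + t *\<^sub>R b) (y t) \<bullet> b) \<le> (t - s) * (p (z + s *\<^sub>R b) (w s) \<bullet> b + r / 2)"
        by (simp add: distrib_left mult.commute[of r])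
      then show "p (z + t *\<^sub>R b) (y t) \<bullet> b \<le> p (z + s *\<^sub>R b) (w s) \<bullet> b + r / 2"
        using \<open>s < t\<close> by simp
    qed
  qed
  moreover have "?A \<in> sets borel"
    unfolding B_def by (intro sets.Int borel_closed borel_open open_ball compact_imp_closed compact_gap_set u)
  ultimately have "negligible ?A" by (rule negligible_if_countable_lines[rotated])
  moreover have "x \<in> ?A"
    using x \<eta>(1) \<open>d > 0\<close> by (simp add: B_def)
  moreover have "openin (top_of_set (gap_set u b r \<inter> interior X)) ?A"
    unfolding openin_open using BX by (intro exI[of _ B] conjI) (auto simp: B_def)
  ultimately show "\<exists>U. openin (top_of_set (gap_set u b r \<inter> interior X)) U \<and> x \<in> U \<and> negligible U"
    by blast
qed

text \<open>Countably many gap sets cover the exceptional set: by injectivity of \<open>p x\<close>,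
  two contact points have gradients differing in some coordinate, by more than
  \<open>1 / Suc n\<close> for a suitable \<open>n\<close>.\<close>

lemma negligible_multiple_contact:
  assumes u: "continuous_on Y u" and twist: "\<And>x. x \<in> X \<Longrightarrow> inj_on (p x) Y"
  shows "negligible {x \<in> interior X. \<nexists>y. contact u x = {y}}"
proof (rule negligible_subset)
  let ?U = "\<Union>b\<in>Basis. \<Union>n. gap_set u b (1 / Suc n) \<inter> interior X"
  have "negligible (\<Union>n. gap_set u b (1 / Suc n) \<inter> interior X)" if "b \<in> Basis" for b
    by (rule negligible_countable_Union) (use that in \<open>force intro: negligible_gap_set u\<close>)+
  then show "negligible ?U"
    by (intro negligible_Union finite_imageI finite_Basis) blast
  show "{x \<in> interior X. \<nexists>y. contact u x = {y}} \<subseteq> ?U"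
  proof safe
    fix x assume x: "x \<in> interior X" and not1: "\<nexists>y. contact u x = {y}"
    have xX: "x \<in> X" using x interior_subset by blast
    obtain y where y: "y \<in> contact u x" using contact_nonempty[OF u xX] by blast
    then obtain w where w: "w \<in> contact u x" "w \<noteq> y" using not1 by blast
    have "p x y \<noteq> p x w"
      using twist[OF xX] y w by (auto simp: inj_on_def contact_def)
    then obtain b where b: "b \<in> Basis" "p x y \<bullet> b \<noteq> p x w \<bullet> b"
      using euclidean_eqI by blast
    obtain y' w' where yw: "y' \<in> contact u x" "w' \<in> contact u x" "p x y' \<bullet> b > p x w' \<bullet> b"
      using b(2) y w by (metis linorder_neqE_linordered_idom)
    then obtain n where "1 / Suc n < p x y' \<bullet> b - p x w' \<bullet> b"
      using nat_approx_posE[of "p x y' \<bullet> b - p x w' \<bullet> b"] by auto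
    then have "x \<in> gap_set u b (1 / Suc n)"
      using yw xX unfolding gap_set_def by force
    then show "x \<in> ?U" using x b by blast
  qed
qed

text \<open>With \<open>w z\<close> a contact point of \<open>z\<close>, the increment of the
  potential lies between the cost increments from \<open>x\<close> to \<open>z\<close> at
  \<open>w z\<close> and at \<open>y\<close>. Both have the slope \<open>p x y\<close> in the limit
  because \<open>w z\<close> tends to \<open>y\<close>.\<close>

lemma conj_fun_has_gradient:
  assumes u: "continuous_on Y u" and x: "x \<in> interior X" and y: "contact u x = {y}"
  shows "GDERIV (conj_fun u) x :> p x y"
proof -
  have xX: "x \<in> X" using x interior_subset by blast
  have yY: "y \<in> Y" "conj_fun u x = c x y - u y" using y by (auto simp: contact_def)
  obtain \<eta> where \<eta>: "\<eta> > 0" "ball x \<eta> \<subseteq> X" using x mem_interior by blast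
  have near: "\<forall>\<^sub>F z in at x. z \<in> ball x \<eta>"
    using \<eta>(1) by (intro eventually_at_in_open') auto
  \<comment> \<open>The selection is arbitrary; its convergence to \<open>y\<close> comes from
    uniqueness of the contact point at \<open>x\<close> alone.\<close>
  define w where "w z = (SOME w. w \<in> contact u z)" for z
  have w: "w z \<in> contact u z" if "z \<in> X" for z
    unfolding w_def using contact_nonempty[OF u that] by (rule someI_ex)
  have wY: "w z \<in> Y" "conj_fun u z = c z (w z) - u (w z)" if "z \<in> X" for z
    using w[OF that] by (auto simp: contact_def)
  have w_lim: "(w \<longlongrightarrow> y) (at x)"
  proof (rule contact_tendsto[OF u xX y])
    show "\<forall>\<^sub>F z in at x. w z \<in> Y"
      using near by eventually_elim (use wY \<eta> in blast)
    have "continuous (at x) (conj_fun u)"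
      using continuous_on_interior[OF conj_fun_continuous[OF u] x] .
    then have 1: "(conj_fun u \<longlongrightarrow> conj_fun u x) (at x)" by (simp add: isCont_def)
    \<comment> \<open>Equicontinuity is uniform in the second argument, so the difference vanishes
      although \<open>w z\<close> moves with \<open>z\<close>. Hence \<open>w z\<close> is
      asymptotically optimal at \<open>x\<close>.\<close>
    have 2: "((\<lambda>z. c x (w z) - c z (w z)) \<longlongrightarrow> 0) (at x)"
    proof (rule tendstoI)
      fix e :: real assume "0 < e"
      then obtain d where "d > 0" and d:
        "\<And>x x' y. \<lbrakk>x \<in> X; x' \<in> X; y \<in> Y; dist x x' < d\<rbrakk> \<Longrightarrow> \<bar>c x y - c x' y\<bar> < e"
        using cost_equicontinuous by blast
      have "\<forall>\<^sub>F z in at x. z \<in> ball x d"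
        using \<open>d > 0\<close> by (intro eventually_at_in_open') auto
      with near show "\<forall>\<^sub>F z in at x. dist (c x (w z) - c z (w z)) 0 < e"
      proof eventually_elim
        case (elim z)
        then have "z \<in> X" using \<eta> by blast
        then show ?case using d[OF xX _ wY(1)] elim by simp
      qed
    qed
    have "((\<lambda>z. conj_fun u z + (c x (w z) - c z (w z))) \<longlongrightarrow> conj_fun u x + 0) (at x)"
      by (intro tendsto_intros 1 2)
    moreover have "\<forall>\<^sub>F z in at x. conj_fun u z + (c x (w z) - c z (w z)) = c x (w z) - u (w z)"
      using near by eventually_elim (use wY \<eta> in force)
    ultimately show "((\<lambda>z. c x (w z) - u (w z)) \<longlongrightarrow> conj_fun u x) (at x)"
      using tendsto_cong by fastforce
  qed
  have p_lim: "((\<lambda>z. p x (w z)) \<longlongrightarrow> p x y) (at x)"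
  proof -
    have "continuous_on Y (p x)"
      by (rule continuous_on_compose2[OF cont_p, of Y "\<lambda>y. (x, y)", simplified])
        (use xX in \<open>auto intro!: continuous_intros\<close>)
    moreover have "\<forall>\<^sub>F z in at x. w z \<in> Y"
      using near by eventually_elim (use wY \<eta> in blast)
    ultimately show ?thesis using continuous_on_tendsto_compose[OF _ w_lim yY(1)] by blast
  qed
  have "(conj_fun u has_derivative (\<lambda>h. p x y \<bullet> h)) (at x)"
    unfolding has_derivative_at_alt
  proof (intro conjI allI impI bounded_linear_inner_right)
    fix e :: real assume "0 < e"
    then have e2: "0 < e / 2" by simp
    obtain d where "d > 0" and lin: "\<And>x z y. \<lbrakk>closed_segment x z \<subseteq> X; y \<in> Y; dist x z < d\<rbrakk> \<Longrightarrow>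
        \<bar>c z y - c x y - p x y \<bullet> (z - x)\<bar> \<le> e / 2 * norm (z - x)"
      using uniform_linearization[OF e2] by blast
    obtain d' where "d' > 0" and d': "\<And>z. \<lbrakk>z \<noteq> x; dist z x < d'\<rbrakk> \<Longrightarrow> dist (p x (w z)) (p x y) < e / 2"
      using tendstoD[OF p_lim e2] unfolding eventually_at by auto
    have "norm (conj_fun u z - conj_fun u x - p x y \<bullet> (z - x)) \<le> e * norm (z - x)"
      if z: "norm (z - x) < min \<eta> (min d d')" for z
    proof (cases "z = x")
      case False
      have "x \<in> ball x \<eta>" "z \<in> ball x \<eta>"
        using z \<eta>(1) by (auto simp: dist_norm norm_minus_commute)
      then have seg: "closed_segment x z \<subseteq> X"
        using closed_segment_subset[OF _ _ convex_ball] \<eta>(2) by blast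
      then have zX: "z \<in> X" by auto
      have dz: "dist x z < d" using z by (simp add: dist_norm norm_minus_commute)
      have "conj_fun u z - conj_fun u x \<le> c z y - c x y"
        using conj_fun_le[OF u zX yY(1)] yY(2) by linarith
      moreover have "conj_fun u z - conj_fun u x \<ge> c z (w z) - c x (w z)"
        using conj_fun_le[OF u xX wY(1)[OF zX]] wY(2)[OF zX] by linarith
      moreover have "\<bar>c z y - c x y - p x y \<bullet> (z - x)\<bar> \<le> e / 2 * norm (z - x)"
        by (rule lin[OF seg yY(1) dz])
      moreover have "\<bar>c z (w z) - c x (w z) - p x (w z) \<bullet> (z - x)\<bar> \<le> e / 2 * norm (z - x)"
        by (rule lin[OF seg wY(1)[OF zX] dz])
      moreover have "\<bar>p x (w z) \<bullet> (z - x) - p x y \<bullet> (z - x)\<bar> \<le> e / 2 * norm (z - x)"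
      proof -
        have "norm (p x (w z) - p x y) \<le> e / 2"
          using d'[OF False] z by (simp add: dist_norm)
        then have "norm (p x (w z) - p x y) * norm (z - x) \<le> e / 2 * norm (z - x)"
          by (rule mult_right_mono) simp
        with Cauchy_Schwarz_ineq2[of "p x (w z) - p x y" "z - x"]
        show ?thesis by (simp add: inner_diff_left)
      qed
      moreover have "0 \<le> e / 2 * norm (z - x)" using \<open>0 < e\<close> by simp
      ultimately show ?thesis unfolding real_norm_def by linarith
    qed simp
    then show "\<exists>d>0. \<forall>z. norm (z - x) < d \<longrightarrow>
        norm (conj_fun u z - conj_fun u x - p x y \<bullet> (z - x)) \<le> e * norm (z - x)"
      using \<eta>(1) \<open>d > 0\<close> \<open>d' > 0\<close> by (intro exI[of _ "min \<eta> (min d d')"]) auto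
  qed
  then show ?thesis by (simp add: gderiv_def inner_commute)
qed

end

subsection \<open>The transport map\<close>

text \<open>Closed sets form an intersection-stable generator, and the indicator of a nonempty
  closed set is a bounded pointwise limit of continuous cutoffs \<open>h k\<close> of the distance
  to it.\<close>

lemma finite_borel_measure_eqI:
  fixes P Q :: "'a::metric_space measure"
  assumes fin: "finite_measure P" "finite_measure Q"
    and sets: "sets P = sets borel" "sets Q = sets borel"
    and eq: "\<And>h :: 'a \<Rightarrow> real. continuous_on UNIV h \<Longrightarrow> (\<And>x. 0 \<le> h x \<and> h x \<le> 1)
      \<Longrightarrow> (\<integral>x. h x \<partial>P) = (\<integral>x. h x \<partial>Q)"
  shows "P = Q"
proof (rule measure_eqI_generator_eq[of "Collect closed" UNIV])
  interpret P: finite_measure P by fact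
  interpret Q: finite_measure Q by fact
  fix F :: "'a set" assume "F \<in> Collect closed"
  then have F: "closed F" by simp
  show "emeasure P F = emeasure Q F"
  proof (cases "F = {}")
    case False
    define h where "h k x = max 0 (1 - real k * infdist x F)" for k x
    have h_cont: "continuous_on UNIV (h k)" for k
      unfolding h_def by (intro continuous_intros)
    have h_bound: "0 \<le> h k x \<and> h k x \<le> 1" for k x
      by (auto simp: h_def infdist_nonneg)
    have h_lim: "(\<lambda>k. h k x) \<longlonglongrightarrow> indicator F x" for x
    proof (cases "x \<in> F")
      case True
      then show ?thesis by (simp add: h_def)
    next
      case outside: False
      then have pos: "0 < infdist x F"
        using in_closed_iff_infdist_zero[OF F False, of x] infdist_nonneg[of x F] by simp
      obtain m :: nat where m: "1 / infdist x F < real m" using reals_Archimedean2 by blast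
      have "h k x = 0" if "k \<ge> m" for k
      proof -
        have "1 / infdist x F \<le> real k" using m that by linarith
        then have "1 \<le> real k * infdist x F" using pos by (simp add: field_simps)
        then show ?thesis by (simp add: h_def)
      qed
      then have "\<forall>\<^sub>F k in sequentially. h k x = indicator F x"
        using outside by (auto simp: eventually_sequentially)
      then show ?thesis by (rule tendsto_eventually)
    qed
    have lim: "(\<lambda>k. \<integral>x. h k x \<partial>R) \<longlonglongrightarrow> measure R F"
      if "finite_measure R" "sets R = sets borel" for R
    proof -
      interpret R: finite_measure R by fact
      have [measurable_cong]: "sets R = sets borel" by fact
      have FR[measurable]: "F \<in> sets R" using F that(2) by simp
      have h_meas: "h k \<in> borel_measurable R" for k
        using borel_measurable_continuous_onI[OF h_cont] measurable_cong_sets[OF that(2) refl] by blast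
      have "(\<lambda>k. \<integral>x. h k x \<partial>R) \<longlonglongrightarrow> (\<integral>x. indicator F x \<partial>R)"
        by (rule integral_dominated_convergence[where w="\<lambda>_. 1"])
          (use h_lim h_bound in \<open>auto intro!: h_meas\<close>)
      also have "(\<integral>x. indicator F x \<partial>R) = measure R F"
        using sets.sets_into_space[OF FR] by (simp add: Int_absorb2)
      finally show ?thesis .
    qed
    have "measure P F = measure Q F"
      using LIMSEQ_unique[OF lim[OF fin(1) sets(1)]] lim[OF fin(2) sets(2)] eq[OF h_cont h_bound]
      by simp
    then show ?thesis by (simp add: P.emeasure_eq_measure Q.emeasure_eq_measure)
  qed simp
next
  show "sets P = sigma_sets UNIV (Collect closed)" "sets Q = sigma_sets UNIV (Collect closed)"
    unfolding sets by (simp_all add: borel_eq_closed)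
  show "emeasure P UNIV \<noteq> \<infinity>" for i :: nat
    using finite_measure.emeasure_finite[OF fin(1)] by simp
qed (auto simp: Int_stable_def)

section \<open>Contact map, first variation and optimal maps\<close>

context transport_problem
begin

lemma closed_in_sets_M: "closed C \<Longrightarrow> C \<inter> X \<in> sets M"
  using sets_M(1) by (auto simp: sets_restrict_space Int_commute)

lemma measurable_id_M: "(\<lambda>x. x) \<in> borel_measurable M"
  unfolding borel_eq_closed
  by (rule measurable_measure_of) (auto simp: sets_M(2) closed_in_sets_M)

lemma measurable_M_N_I:
  assumes "f \<in> borel_measurable M" "\<And>x. x \<in> X \<Longrightarrow> f x \<in> Y"
  shows "f \<in> measurable M N"
  unfolding measurable_cong_sets[OF refl sets_N]
  by (rule measurable_restrict_space2) (use assms in \<open>auto simp: sets_M(2)\<close>)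

lemma
  assumes "f \<in> measurable M N"
  shows measurable_M_N_borel: "f \<in> borel_measurable M" and M_N_range: "x \<in> X \<Longrightarrow> f x \<in> Y"
  using assms unfolding measurable_cong_sets[OF refl sets_N] measurable_restrict_space2_iff sets_M(2)
  by blast+

lemma integrable_cost:
  assumes f: "f \<in> measurable M N"
  shows "integrable M (\<lambda>x. c x (f x))"
proof -
  have "(\<lambda>x. (x, f x)) \<in> measurable M (restrict_space borel (X \<times> Y))"
    by (intro measurable_restrict_space2 borel_measurable_Pair measurable_id_M measurable_M_N_borel[OF f])
      (use M_N_range[OF f] in \<open>auto simp: sets_M(2)\<close>)
  from measurable_compose[OF this borel_measurable_continuous_on_restrict[OF cont]]
  have "(\<lambda>x. c x (f x)) \<in> borel_measurable M" by simp
  moreover obtain B where "\<And>x y. x \<in> X \<Longrightarrow> y \<in> Y \<Longrightarrow> \<bar>c x y\<bar> \<le> B"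
    using cost_bounded by blast
  ultimately show ?thesis
    by (intro integrable_const_bound[of _ B] AE_I2) (use M_N_range[OF f] in \<open>auto simp: sets_M(2)\<close>)
qed

text \<open>Off a null set the selection is forced, and there the preimage of a closed set
  \<open>F\<close> is the projection of the compact part of the contact graph lying over
  \<open>F\<close>.\<close>

lemma measurable_selection:
  assumes u: "continuous_on Y u" and unique: "AE x in M. \<exists>y. contact u x = {y}"
  obtains S where "S \<in> measurable M N" "AE x in M. contact u x = {S x}"
proof -
  obtain Z where Z: "{x \<in> space M. \<not> (\<exists>y. contact u x = {y})} \<subseteq> Z" "Z \<in> sets M" "emeasure M Z = 0"
    using unique by (rule AE_E)
  obtain y0 where y0: "y0 \<in> Y" using Y by blast
  \<comment> \<open>The default \<open>y0\<close> on the measurable null set \<open>Z\<close> keeps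
    \<open>S\<close> inside \<open>Y\<close> everywhere and contributes either \<open>Z\<close> or
    nothing to a preimage.\<close>
  define S where "S x = (if x \<in> Z then y0 else THE y. contact u x = {y})" for x
  have S: "contact u x = {S x}" if "x \<in> X" "x \<notin> Z" for x
  proof -
    have "x \<in> space M" using that by (simp add: sets_M(2))
    then have "\<exists>y. contact u x = {y}" using Z(1) \<open>x \<notin> Z\<close> by blast
    then obtain y where "contact u x = {y}" by (rule exE)
    then show ?thesis using that by (simp add: S_def)
  qed
  have SY: "S x \<in> Y" if "x \<in> X" for x
    using S[OF that] y0 by (cases "x \<in> Z") (auto simp: S_def contact_def)
  have "S \<in> borel_measurable M"
    unfolding borel_eq_closed
  proof (rule measurable_measure_of)
    fix F :: "plane set" assume "F \<in> Collect closed"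
    then have F: "closed F" by simp
    let ?C = "fst ` ({(x, y). x \<in> X \<and> y \<in> contact u x} \<inter> UNIV \<times> F)"
    have "compact ?C"
      by (intro compact_continuous_image continuous_intros compact_Int_closed compact_contact u closed_Times F closed_UNIV)
    then have "(?C \<inter> X - Z) \<union> (if y0 \<in> F then Z else {}) \<in> sets M"
      using closed_in_sets_M[OF compact_imp_closed] Z(2) by auto
    also have "(?C \<inter> X - Z) \<union> (if y0 \<in> F then Z else {}) = S -` F \<inter> space M"
    proof (intro set_eqI)
      fix x
      have "Z \<subseteq> X" using sets.sets_into_space[OF Z(2)] by (simp add: sets_M(2))
      then show "x \<in> (?C \<inter> X - Z) \<union> (if y0 \<in> F then Z else {}) \<longleftrightarrow> x \<in> S -` F \<inter> space M"
      proof (cases "x \<in> Z")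
        case True
        then show ?thesis using \<open>Z \<subseteq> X\<close> by (auto simp: sets_M(2) S_def)
      next
        case False
        have "x \<in> ?C \<longleftrightarrow> x \<in> X \<and> S x \<in> F"
        proof (cases "x \<in> X")
          case True
          then show ?thesis using S[OF True False] by (force simp: image_iff)
        qed auto
        with False show ?thesis by (auto simp: sets_M(2))
      qed
    qed
    finally show "S -` F \<inter> space M \<in> sets M" .
  qed auto
  then have "S \<in> measurable M N" using SY by (rule measurable_M_N_I)
  moreover have "AE x in M. contact u x = {S x}"
    by (rule AE_I[OF _ Z(3,2)]) (use S in \<open>auto simp: sets_M(2)\<close>)
  ultimately show ?thesis by (rule that)
qed

text \<open>An envelope theorem: the difference quotient lies between \<open>h y\<close> and
  \<open>h (w n)\<close>, where \<open>w n\<close> minimizes the perturbed problem, and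
  \<open>w n\<close> tends to the unique contact point \<open>y\<close>.\<close>

lemma perturbed_conj_fun_limit:
  fixes h :: "plane \<Rightarrow> real"
  assumes u: "continuous_on Y u" and h: "continuous_on Y h" and x: "x \<in> X" "contact u x = {y}"
    and B: "\<And>y. y \<in> Y \<Longrightarrow> \<bar>h y\<bar> \<le> B"
  shows "(\<lambda>n. Suc n * (conj_fun u x - conj_fun (\<lambda>y. u y + h y / Suc n) x)) \<longlonglongrightarrow> h y"
proof -
  let ?v = "\<lambda>n y. u y + h y / Suc n"
  have v: "continuous_on Y (?v n)" for n by (intro continuous_intros u h) simp
  have y: "y \<in> Y" "conj_fun u x = c x y - u y" using x(2) by (auto simp: contact_def)
  obtain w where w: "\<And>n. w n \<in> Y" "\<And>n. conj_fun (?v n) x = c x (w n) - ?v n (w n)"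
    using conj_fun_attained[OF v x(1)] by metis
  have B': "\<bar>h y / Suc n\<bar> \<le> B / Suc n" if "y \<in> Y" for y n
    using B[OF that] by (simp add: divide_right_mono)
  \<comment> \<open>The factor 2 accounts for the perturbation at \<open>w n\<close> and at
    \<open>y\<close>, each at most \<open>B / Suc n\<close>; together they bound the defect of
    \<open>w n\<close> in the unperturbed problem.\<close>
  have B0: "(\<lambda>n. 2 * (B / Suc n)) \<longlonglongrightarrow> 0"
    using tendsto_mult_right_zero[OF LIMSEQ_Suc[OF lim_const_over_n[of B]]] by simp
  have "w \<longlonglongrightarrow> y"
  proof (rule contact_tendsto[OF u x])
    have "(\<lambda>n. c x (w n) - u (w n) - conj_fun u x) \<longlonglongrightarrow> 0"
    proof (rule Lim_null_comparison[OF always_eventually B0], rule allI)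
      fix n
      show "norm (c x (w n) - u (w n) - conj_fun u x) \<le> 2 * (B / Suc n)"
        using conj_fun_le[OF v x(1) y(1), of n] conj_fun_le[OF u x(1) w(1), of n] w(2)[of n] y
          B'[OF w(1), of n n] B'[OF y(1), of n] unfolding real_norm_def by linarith
    qed
    then show "(\<lambda>n. c x (w n) - u (w n)) \<longlonglongrightarrow> conj_fun u x" by (rule LIM_zero_cancel)
  qed (simp add: w)
  then have hw: "(\<lambda>n. h (w n)) \<longlonglongrightarrow> h y"
    by (rule continuous_on_tendsto_compose[OF h _ y(1)]) (simp add: w(1) always_eventually)
  show ?thesis
  proof (rule tendsto_sandwich[OF always_eventually always_eventually tendsto_const hw]; rule allI)
    fix n
    have "h y / Suc n \<le> conj_fun u x - conj_fun (?v n) x"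
      using conj_fun_le[OF v x(1) y(1), of n] y(2) by linarith
    then show "h y \<le> Suc n * (conj_fun u x - conj_fun (?v n) x)"
      by (simp add: pos_divide_le_eq mult.commute)
    have "conj_fun u x - conj_fun (?v n) x \<le> h (w n) / Suc n"
      using conj_fun_le[OF u x(1) w(1), of n] w(2)[of n] by linarith
    then show "Suc n * (conj_fun u x - conj_fun (?v n) x) \<le> h (w n)"
      by (simp add: pos_le_divide_eq mult.commute)
  qed
qed

text \<open>The first variation of the dual functional in the direction \<open>h\<close>; equality follows by
  replacing \<open>h\<close> with \<open>- h\<close>.\<close>

lemma maximizer_integral_le:
  fixes h :: "plane \<Rightarrow> real"
  assumes u: "continuous_on Y u" and max: "\<And>w. continuous_on Y w \<Longrightarrow> dual_value w \<le> dual_value u"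
    and S: "S \<in> measurable M N" "AE x in M. contact u x = {S x}" and h: "continuous_on Y h"
  shows "(\<integral>y. h y \<partial>N) \<le> (\<integral>x. h (S x) \<partial>M)"
proof -
  let ?v = "\<lambda>n y. u y + h y / Suc n"
  let ?q = "\<lambda>n x. Suc n * (conj_fun u x - conj_fun (?v n) x)"
  have v: "continuous_on Y (?v n)" for n by (intro continuous_intros u h) simp
  note cu = conj_fun_continuous[OF u] and cv = conj_fun_continuous[OF v]
  have "bounded (h ` Y)"
    by (intro compact_imp_bounded compact_continuous_image h Y)
  then obtain B where B: "\<And>y. y \<in> Y \<Longrightarrow> \<bar>h y\<bar> \<le> B" by (auto simp: bounded_iff)
  have q: "continuous_on X (?q n)" for n by (intro continuous_intros cu cv)
  have "(\<lambda>n. \<integral>x. ?q n x \<partial>M) \<longlonglongrightarrow> (\<integral>x. h (S x) \<partial>M)"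
  proof (rule integral_dominated_convergence[where w="\<lambda>_. B"])
    show "(\<lambda>x. h (S x)) \<in> borel_measurable M"
      by (rule measurable_compose[OF S(1) measurable_N[OF h]])
    show "?q n \<in> borel_measurable M" for n by (rule measurable_M[OF q])
    show "AE x in M. (\<lambda>n. ?q n x) \<longlonglongrightarrow> h (S x)"
      using S(2) AE_space
    proof eventually_elim
      case (elim x)
      then show ?case using perturbed_conj_fun_limit[OF u h _ _ B] by (simp add: sets_M(2))
    qed
    show "AE x in M. norm (?q n x) \<le> B" for n
    proof (rule AE_I2)
      fix x assume "x \<in> space M"
      then have x: "x \<in> X" by (simp add: sets_M(2))
      have "\<bar>u y - ?v n y\<bar> \<le> B / Suc n" if "y \<in> Y" for y
        using B[OF that] by (simp add: divide_right_mono)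
      then have "\<bar>conj_fun u x - conj_fun (?v n) x\<bar> \<le> B / Suc n"
        by (rule compact_cost.transform_contraction[OF flip u v x])
      then have "real (Suc n) * \<bar>conj_fun u x - conj_fun (?v n) x\<bar> \<le> B"
        by (subst (asm) pos_le_divide_eq) (simp_all add: mult.commute)
      then show "norm (?q n x) \<le> B" by (simp add: abs_mult)
    qed
  qed simp
  \<comment> \<open>Maximality of \<open>u\<close> against the competitor \<open>?v n\<close>,
    multiplied by \<open>Suc n\<close>.\<close>
  moreover have "(\<integral>y. h y \<partial>N) \<le> (\<integral>x. ?q n x \<partial>M)" for n
  proof -
    have "(\<integral>y. ?v n y \<partial>N) = (\<integral>y. u y \<partial>N) + (\<integral>y. h y \<partial>N) / Suc n"
      using integrable_N[OF u] integrable_N[OF h] by simp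
    then have "(\<integral>y. h y \<partial>N) / Suc n \<le> (\<integral>x. conj_fun u x \<partial>M) - (\<integral>x. conj_fun (?v n) x \<partial>M)"
      using max[OF v, of n] unfolding dual_value_def by linarith
    then have "(\<integral>y. h y \<partial>N) \<le> Suc n * ((\<integral>x. conj_fun u x \<partial>M) - (\<integral>x. conj_fun (?v n) x \<partial>M))"
      by (subst (asm) pos_divide_le_eq) (simp_all add: mult.commute)
    also have "\<dots> = (\<integral>x. ?q n x \<partial>M)"
      using integrable_M[OF cu] integrable_M[OF cv] by simp
    finally show ?thesis .
  qed
  ultimately show ?thesis by (intro LIMSEQ_le_const) auto
qed

text \<open>The first variation with \<open>h\<close> and with its negative shows that both measures
  integrate continuous functions alike, which determines them.\<close>

lemma maximizer_pushforward:
  assumes u: "continuous_on Y u" and max: "\<And>w. continuous_on Y w \<Longrightarrow> dual_value w \<le> dual_value u"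
    and S: "S \<in> measurable M N" "AE x in M. contact u x = {S x}"
  shows "distr M N S = N"
proof -
  note S_borel = measurable_M_N_borel[OF S(1)]
  have id_borel: "(\<lambda>y. y) \<in> measurable N borel"
    unfolding measurable_cong_sets[OF sets_N refl] by (rule measurable_restrict_space1) simp
  \<comment> \<open>Both measures are first moved to the Borel sets of the whole plane, where
    \<open>finite_borel_measure_eqI\<close> applies.\<close>
  have *: "distr M borel S = distr N borel (\<lambda>y. y)"
  proof (rule finite_borel_measure_eqI)
    fix h :: "plane \<Rightarrow> real" assume "continuous_on UNIV h"
    then have h: "continuous_on Y h" "continuous_on Y (\<lambda>y. - h y)" "h \<in> borel_measurable borel"
      by (auto intro: continuous_on_subset borel_measurable_continuous_onI continuous_intros)
    show "(\<integral>x. h x \<partial>distr M borel S) = (\<integral>x. h x \<partial>distr N borel (\<lambda>y. y))"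
      using maximizer_integral_le[OF u max S h(1)] maximizer_integral_le[OF u max S h(2)]
      by (simp add: integral_distr[OF S_borel h(3)] integral_distr[OF id_borel h(3)])
  qed (auto intro: finite_measure_distr N.finite_measure_distr S_borel id_borel)
  show ?thesis
  proof (rule measure_eqI)
    fix A assume "A \<in> sets (distr M N S)"
    then have A: "A \<in> sets N" by simp
    have "Y \<in> sets borel" using Y(1) by (simp add: borel_compact)
    then have A': "A \<in> sets borel" using A by (auto simp: sets_N sets_restrict_space)
    have "emeasure (distr M N S) A = emeasure (distr M borel S) A"
      by (simp add: emeasure_distr S(1) S_borel A A')
    also have "\<dots> = emeasure N A"
      unfolding * using sets.sets_into_space[OF A]
      by (simp add: emeasure_distr id_borel A' Int_absorb2)
    finally show "emeasure (distr M N S) A = emeasure N A" .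
  qed simp
qed

text \<open>The duality gap \<open>c x (T x) - (conj_fun u x + u (T x))\<close> is nonnegative. It
  integrates to at most 0, since \<open>u\<close> has the same integral along \<open>S\<close> and
  \<open>T\<close> and the gap of \<open>S\<close> vanishes; hence it is 0 almost
  everywhere.\<close>

lemma optimal_map_in_contact:
  assumes u: "continuous_on Y u"
    and S: "S \<in> measurable M N" "distr M N S = N" "AE x in M. S x \<in> contact u x"
    and T: "T \<in> measurable M N" "distr M N T = N"
    and le: "(\<integral>x. c x (T x) \<partial>M) \<le> (\<integral>x. c x (S x) \<partial>M)"
  shows "AE x in M. T x \<in> contact u x"
proof -
  note cu = conj_fun_continuous[OF u]
  have push: "(\<integral>x. u (f x) \<partial>M) = (\<integral>y. u y \<partial>N)" "integrable M (\<lambda>x. u (f x))"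
    if f: "f \<in> measurable M N" "distr M N f = N" for f
    using integral_distr[OF f(1) measurable_N[OF u]] integrable_distr_eq[OF f(1) measurable_N[OF u]]
      integrable_N[OF u] unfolding f(2) by auto
  have "(\<integral>x. c x (S x) \<partial>M) = (\<integral>x. conj_fun u x + u (S x) \<partial>M)"
  proof (rule integral_cong_AE)
    show "AE x in M. c x (S x) = conj_fun u x + u (S x)"
      using S(3) by eventually_elim (simp add: contact_def)
  qed (use push(2)[OF S(1,2)] integrable_cost[OF S(1)] integrable_M[OF cu] in simp_all)
  also have "\<dots> = (\<integral>x. conj_fun u x + u (T x) \<partial>M)"
    using push[OF S(1,2)] push[OF T] integrable_M[OF cu] by simp
  finally have "(\<integral>x. c x (T x) - (conj_fun u x + u (T x)) \<partial>M) \<le> 0"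
    using le integrable_cost[OF T(1)] push(2)[OF T] integrable_M[OF cu] by simp
  moreover have nonneg: "AE x in M. 0 \<le> c x (T x) - (conj_fun u x + u (T x))"
  proof (rule AE_I2)
    fix x assume "x \<in> space M"
    then have "x \<in> X" by (simp add: sets_M(2))
    then show "0 \<le> c x (T x) - (conj_fun u x + u (T x))"
      using conj_fun_le[OF u _ M_N_range[OF T(1)]] by fastforce
  qed
  moreover have "integrable M (\<lambda>x. c x (T x) - (conj_fun u x + u (T x)))"
    using integrable_cost[OF T(1)] push(2)[OF T] integrable_M[OF cu] by simp
  ultimately have "AE x in M. c x (T x) - (conj_fun u x + u (T x)) = 0"
    using integral_nonneg_eq_0_iff_AE[OF _ nonneg] integral_nonneg_AE[OF nonneg] by simp
  then show ?thesis
    using AE_space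
  proof eventually_elim
    case (elim x)
    then show ?case using M_N_range[OF T(1)] by (auto simp: contact_def sets_M(2))
  qed
qed

end

subsection \<open>Densities and gradients\<close>

lemma outer_product_mult: "outer_product u v *v w = (v \<bullet> w) *\<^sub>R (u :: real ^ 'n)"
  by (simp add: vec_eq_iff outer_product_def matrix_vector_mult_def inner_vec_def
      sum_distrib_left sum_distrib_right mult_ac)

text \<open>Tangentiality expresses the last component of \<open>D\<close> as
  \<open>v \<bullet> P\<close> with \<open>P = fst D\<close>. Adding
  \<open>\<alpha> *\<^sub>R v\<close> to \<open>a\<close> cancels the multiplier \<open>l\<close>
  and leaves \<open>P + (v \<bullet> P) *\<^sub>R v\<close>; the matrix is the Sherman-Morrison
  inverse of this rank-one perturbation of the identity.\<close>

lemma tangential_gradient_component: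
  fixes a v :: "real ^ 'n" and D :: "(real ^ 'n) \<times> real"
  assumes snell: "(a, \<alpha>) = l *\<^sub>R (- v, 1) + D" and tang: "D \<bullet> (- v, 1) = 0"
  shows "fst D = (mat 1 - (1 / (1 + (norm v)\<^sup>2)) *\<^sub>R outer_product v v) *v (a + \<alpha> *\<^sub>R v)"
proof -
  obtain P q where D: "D = (P, q)" by (cases D)
  have q: "q = v \<bullet> P" using tang by (simp add: D inner_commute)
  have a: "a = P - l *\<^sub>R v" and \<alpha>: "\<alpha> = l + q" using snell by (simp_all add: D)
  have sum: "a + \<alpha> *\<^sub>R v = P + (v \<bullet> P) *\<^sub>R v" by (simp add: a \<alpha> q algebra_simps)
  have "v \<bullet> (P + (v \<bullet> P) *\<^sub>R v) = (1 + (norm v)\<^sup>2) * (v \<bullet> P)"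
    by (simp add: inner_add_right power2_norm_eq_inner algebra_simps)
  moreover have "1 + (norm v)\<^sup>2 \<noteq> 0" by (smt (verit) zero_le_power2)
  ultimately show ?thesis
    by (simp add: sum D matrix_vector_mult_diff_rdistrib scaleR_matrix_vector_assoc[symmetric] outer_product_mult
        del: scaleR_add_right)
qed

section \<open>Measures with a Lebesgue density\<close>

lemma set_integrable_imp_integrable_lebesgue_on:
  "\<lbrakk>S \<in> sets lebesgue; set_integrable lebesgue S \<rho>\<rbrakk> \<Longrightarrow> integrable (lebesgue_on S) \<rho>"
  for S :: "'a::euclidean_space set" and \<rho> :: "'a \<Rightarrow> real"
  by (simp add: integrable_restrict_space set_integrable_def)

lemma emeasure_density_lebesgue_on:
  fixes S :: "'a::euclidean_space set"
  assumes S: "S \<in> sets lebesgue" and int: "set_integrable lebesgue S \<rho>" and nonneg: "\<forall>x\<in>S. 0 \<le> \<rho> x"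
    and A: "A \<in> sets lebesgue" "A \<subseteq> S"
  shows "emeasure (density (lebesgue_on S) \<rho>) A = ennreal (LINT x:A|lebesgue. \<rho> x)"
proof -
  have A': "A \<in> sets (lebesgue_on S)" using A S by (simp add: sets_restrict_space_iff)
  note int' = set_integrable_imp_integrable_lebesgue_on[OF S int]
  have "emeasure (density (lebesgue_on S) \<rho>) A = (\<integral>\<^sup>+ x. ennreal (indicator A x *\<^sub>R \<rho> x) \<partial>lebesgue_on S)"
    using A' int' by (subst emeasure_density) (auto intro!: nn_integral_cong simp: indicator_def)
  also have "\<dots> = ennreal (\<integral>x. indicator A x *\<^sub>R \<rho> x \<partial>lebesgue_on S)"
    using A' nonneg
    by (intro nn_integral_eq_integral integrable_mult_indicator int' AE_I2)
      (auto simp: space_restrict_space)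
  also have "(\<integral>x. indicator A x *\<^sub>R \<rho> x \<partial>lebesgue_on S) = (LINT x:A|lebesgue. \<rho> x)"
    using S A(2) by (subst integral_restrict_space)
      (auto simp: set_lebesgue_integral_def indicator_def intro!: Bochner_Integration.integral_cong)
  finally show ?thesis .
qed

lemma set_integral_nonneg_subset:
  assumes "\<forall>x\<in>S. 0 \<le> (\<rho> x :: real)" "A \<subseteq> S"
  shows "0 \<le> (LINT x:A|M. \<rho> x)"
  unfolding set_lebesgue_integral_def using assms
  by (intro Bochner_Integration.integral_nonneg) (auto simp: indicator_def)

section \<open>Gradient of the cost\<close>

lemma C1_on_Times_partial:
  assumes c: "C1_on (A \<times> B) (\<lambda>(x, y). c x y) Dc" and xy: "x \<in> A" "y \<in> B"
  shows "((\<lambda>x. c x y) has_derivative (\<lambda>h. fst (Dc (x, y)) \<bullet> h)) (at x within A)"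
proof -
  have "((\<lambda>x. (x, y)) has_derivative (\<lambda>h. (h, 0))) (at x within A)"
    by (auto intro!: derivative_eq_intros)
  moreover have "((\<lambda>(x, y). c x y) has_derivative (\<lambda>h. Dc (x, y) \<bullet> h)) (at (x, y) within (\<lambda>x. (x, y)) ` A)"
    by (rule has_derivative_subset[of _ _ _ "A \<times> B"]) (use c xy in \<open>auto simp: C1_on_def\<close>)
  ultimately show ?thesis
    using has_derivative_in_compose[of "\<lambda>x. (x, y)" _ x A "\<lambda>(x, y). c x y"]
    by (fastforce simp: inner_prod_def)
qed

lemma C1_on_continuous: "C1_on D u Du \<Longrightarrow> continuous_on D u"
  unfolding C1_on_def using has_derivative_continuous continuous_on_eq_continuous_within by blast

text \<open>As a distance between points of the two surfaces, the cost is bounded below by their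
  separation.\<close>

lemma cost_eq_dist: "cost \<phi> f g x y = dist (\<phi> x, f (\<phi> x)) (y, g y)"
  by (simp add: cost_def dist_norm norm_Pair power2_commute[of "g y"] add.commute)

text \<open>The chain rule yields one derivative, positivity of the cost making the square root
  differentiable; uniqueness of derivatives at an interior point identifies it with the given
  \<open>d\<close>.\<close>

lemma cost_gradient:
  assumes \<phi>: "C2_map_on \<Omega> \<phi> J" and f: "C1_on (\<phi> ` \<Omega>) f Df"
    and x: "x \<in> interior \<Omega>" and pos: "0 < cost \<phi> f g x y"
    and D: "((\<lambda>x. cost \<phi> f g x y) has_derivative (\<lambda>h. d \<bullet> h)) (at x within \<Omega>)"
  shows "d = transpose (J x) *v ((1 / cost \<phi> f g x y) *\<^sub>R (\<phi> x - y - (g y - f (\<phi> x)) *\<^sub>R Df (\<phi> x)))"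
    (is "_ = _ *v ?w")
proof -
  have xD: "x \<in> \<Omega>" using x interior_subset by blast
  have at: "at x within \<Omega> = at x" using at_within_interior[OF x] .
  have d\<phi>: "(\<phi> has_derivative (\<lambda>h. J x *v h)) (at x within \<Omega>)"
  proof (subst has_derivative_componentwise_within, rule ballI)
    fix b :: plane assume "b \<in> Basis"
    then obtain i where b: "b = axis i 1" by (auto simp: Basis_vec_def)
    have "((\<lambda>x. \<phi> x $ i) has_derivative (\<lambda>h. J x $ i \<bullet> h)) (at x within \<Omega>)"
      using \<phi> xD by (auto simp: C2_map_on_def C1_on_def)
    then show "((\<lambda>x. \<phi> x \<bullet> b) has_derivative (\<lambda>h. (J x *v h) \<bullet> b)) (at x within \<Omega>)"
      by (simp add: b inner_axis matrix_vector_mul_component)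
  qed
  have df: "((\<lambda>x. f (\<phi> x)) has_derivative (\<lambda>h. Df (\<phi> x) \<bullet> (J x *v h))) (at x within \<Omega>)"
    using has_derivative_in_compose[OF d\<phi>, of f "\<lambda>h. Df (\<phi> x) \<bullet> h"] f xD by (auto simp: C1_on_def)
  let ?q = "\<lambda>x. (g y - f (\<phi> x)) * (g y - f (\<phi> x)) + (\<phi> x - y) \<bullet> (\<phi> x - y)"
  have cost: "cost \<phi> f g z y = sqrt (?q z)" for z
    by (simp add: cost_def power2_eq_square[symmetric] power2_norm_eq_inner)
  have "0 < ?q x" using pos unfolding cost by simp
  \<comment> \<open>The left side is the raw output of the product rules for \<open>?q\<close>; the
    zeros are derivatives of constants.\<close>
  have product_rules: "a * (0 - v \<bullet> w) + (0 - v \<bullet> w) * a + (z \<bullet> (w - 0) + (w - 0) \<bullet> z) = 2 * ((z - a *\<^sub>R v) \<bullet> w)"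
    for a :: real and v w z :: plane
    by (simp add: inner_diff_left inner_commute[of w] algebra_simps)
  have sqrt_rule: "2 * (v \<bullet> w) * (inverse r / 2) = ((1 / r) *\<^sub>R v) \<bullet> w" for r :: real and v w :: plane
    unfolding inner_scaleR_left by (simp add: inverse_eq_divide)
  have dq: "(?q has_derivative
      (\<lambda>h. 2 * ((\<phi> x - y - (g y - f (\<phi> x)) *\<^sub>R Df (\<phi> x)) \<bullet> (J x *v h)))) (at x within \<Omega>)"
    by (rule has_derivative_eq_rhs, (rule derivative_intros d\<phi> df)+) (rule ext, rule product_rules)
  have "((\<lambda>x. sqrt (?q x)) has_derivative (\<lambda>h. ?w \<bullet> (J x *v h))) (at x within \<Omega>)"
    by (rule has_derivative_eq_rhs[OF has_derivative_real_sqrt[OF \<open>0 < ?q x\<close> dq]], rule ext,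
        unfold cost, rule sqrt_rule)
  then have "((\<lambda>x. cost \<phi> f g x y) has_derivative (\<lambda>h. ?w \<bullet> (J x *v h))) (at x)"
    using cost at by simp
  from has_derivative_unique[OF this] D have "(\<lambda>h. ?w \<bullet> (J x *v h)) = (\<lambda>h. d \<bullet> h)"
    unfolding at by blast
  then have "d \<bullet> h = (transpose (J x) *v ?w) \<bullet> h" for h
    unfolding fun_eq_iff by (simp only: transpose_matrix_vector dot_lmul_matrix)
  then show ?thesis using vector_eq_rdot by blast
qed

lemma matrix_inv_mult_vector:
  fixes A :: "real ^ 'n ^ 'n"
  assumes "invertible A"
  shows "matrix_inv A *v (A *v w) = w"
  using assms someI_ex[of "\<lambda>A'. A ** A' = mat 1 \<and> A' ** A = mat 1"]
  by (simp add: matrix_vector_mul_assoc matrix_inv_def invertible_def)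

section \<open>Densities as marginals of a transport problem\<close>

lemma borel_subset_lebesgue_on: "sets (restrict_space borel S) \<subseteq> sets (lebesgue_on S)"
  for S :: "'a::euclidean_space set"
  unfolding sets_restrict_space by (intro image_mono subsetI) simp

lemma emeasure_distr_density_lebesgue_on:
  fixes S :: "'a::euclidean_space set"
  assumes S: "S \<in> sets lebesgue" and int: "set_integrable lebesgue S \<rho>" and nonneg: "\<forall>x\<in>S. 0 \<le> \<rho> x"
    and A: "A \<in> sets borel" "A \<subseteq> S"
  shows "emeasure (distr (density (lebesgue_on S) \<rho>) (restrict_space borel S) (\<lambda>y. y)) A
    = ennreal (LINT x:A|lebesgue. \<rho> x)"
proof -
  have "(\<lambda>y. y) \<in> measurable (density (lebesgue_on S) \<rho>) (restrict_space borel S)"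
    using borel_subset_lebesgue_on[of S] sets.sets_into_space[of _ "restrict_space borel S"]
    by (intro measurableI) (auto simp: space_restrict_space Int_absorb2)
  moreover have "A \<in> sets (restrict_space borel S)" using A by (auto simp: sets_restrict_space)
  moreover have "emeasure (density (lebesgue_on S) \<rho>) A = ennreal (LINT x:A|lebesgue. \<rho> x)"
    using A by (intro emeasure_density_lebesgue_on S int nonneg) auto
  ultimately show ?thesis
    using A(2) by (simp add: emeasure_distr space_restrict_space Int_absorb2)
qed

text \<open>A density positive almost everywhere has the same null sets as Lebesgue measure on
  \<open>S\<close>, so conclusions about the weighted measure become Lebesgue almost everywhere
  statements.\<close>

lemma AE_density_lebesgue_on_iff:
  fixes S :: "'a::euclidean_space set"
  assumes S: "S \<in> sets lebesgue" and int: "set_integrable lebesgue S \<rho>"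
    and pos: "AE x\<in>S in lebesgue. 0 < \<rho> x"
  shows "(AE x in density (lebesgue_on S) (\<lambda>x. ennreal (\<rho> x)). P x) \<longleftrightarrow> (AE x\<in>S in lebesgue. P x)"
proof -
  have "integrable (lebesgue_on S) \<rho>"
    by (rule set_integrable_imp_integrable_lebesgue_on[OF S int])
  then have "(AE x in density (lebesgue_on S) (\<lambda>x. ennreal (\<rho> x)). P x)
      \<longleftrightarrow> (AE x\<in>S in lebesgue. 0 < \<rho> x \<longrightarrow> P x)"
    using S by (subst AE_density) (auto simp: AE_restrict_space_iff)
  also have "\<dots> \<longleftrightarrow> (AE x\<in>S in lebesgue. P x)"
  proof
    assume "AE x\<in>S in lebesgue. 0 < \<rho> x \<longrightarrow> P x"
    with pos show "AE x\<in>S in lebesgue. P x" by eventually_elim blast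
  next
    assume "AE x\<in>S in lebesgue. P x"
    then show "AE x\<in>S in lebesgue. 0 < \<rho> x \<longrightarrow> P x" by eventually_elim blast
  qed
  finally show ?thesis .
qed

lemma set_integral_eq_integral_density:
  fixes S :: "'a::euclidean_space set" and h \<rho> :: "'a \<Rightarrow> real"
  assumes S: "S \<in> sets lebesgue" and int: "set_integrable lebesgue S \<rho>" and nonneg: "\<forall>x\<in>S. 0 \<le> \<rho> x"
    and h: "h \<in> borel_measurable (lebesgue_on S)"
  shows "(LINT x:S|lebesgue. h x * \<rho> x) = (\<integral>x. h x \<partial>density (lebesgue_on S) (\<lambda>x. ennreal (\<rho> x)))"
proof -
  have "integrable (lebesgue_on S) \<rho>"
    by (rule set_integrable_imp_integrable_lebesgue_on[OF S int])
  then have "(\<integral>x. h x \<partial>density (lebesgue_on S) (\<lambda>x. ennreal (\<rho> x))) = (\<integral>x. h x * \<rho> x \<partial>lebesgue_on S)"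
    using nonneg h by (subst integral_density) (auto intro!: AE_I2 simp: space_restrict_space mult.commute)
  also have "\<dots> = (LINT x:S|lebesgue. h x * \<rho> x)"
    using S by (subst integral_restrict_space) (auto simp: set_lebesgue_integral_def)
  finally show ?thesis by simp
qed

lemma transport_problem_density:
  assumes c: "compact_cost X Y c" and leb: "X \<in> sets lebesgue" "Y \<in> sets lebesgue"
    and \<rho>: "\<forall>x\<in>X. 0 \<le> \<rho> x" "set_integrable lebesgue X \<rho>"
    and \<sigma>: "\<forall>y\<in>Y. 0 \<le> \<sigma> y" "set_integrable lebesgue Y \<sigma>"
    and mass: "(LINT x:X|lebesgue. \<rho> x) = (LINT y:Y|lebesgue. \<sigma> y)"
  shows "transport_problem X Y c (density (lebesgue_on X) (\<lambda>x. ennreal (\<rho> x)))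
    (distr (density (lebesgue_on Y) (\<lambda>y. ennreal (\<sigma> y))) (restrict_space borel Y) (\<lambda>y. y))"
    (is "transport_problem X Y c ?M ?N")
proof -
  interpret compact_cost X Y c by fact
  have MX: "emeasure ?M X = ennreal (LINT x:X|lebesgue. \<rho> x)"
    by (rule emeasure_density_lebesgue_on) (use leb \<rho> in auto)
  have NY: "emeasure ?N Y = ennreal (LINT y:Y|lebesgue. \<sigma> y)"
    by (rule emeasure_distr_density_lebesgue_on) (use leb \<sigma> Y in \<open>auto intro: borel_compact\<close>)
  show ?thesis
  proof (intro transport_problem.intro transport_problem_axioms.intro c)
    show "finite_measure ?M" "finite_measure ?N"
      by (rule finite_measureI; simp add: space_restrict_space MX NY)+
    show "measure ?M X = measure ?N Y" by (simp add: measure_def MX NY mass)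
  qed (use borel_subset_lebesgue_on in \<open>auto simp: space_restrict_space\<close>)
qed

theorem theorem3p2:
  fixes \<Omega>\<^sub>0 \<Omega>\<^sub>0' \<Omega>\<^sub>1 :: "plane set"
    and e :: "plane \<Rightarrow> space"
    and \<phi> :: "plane \<Rightarrow> plane" and J :: "plane \<Rightarrow> real ^ 2 ^ 2"
    and f g :: "plane \<Rightarrow> real" and Df Dg :: "plane \<Rightarrow> plane"
    and \<beta> n\<^sub>1 n\<^sub>2 n\<^sub>3 :: real
    and \<rho>\<^sub>0 \<rho>\<^sub>1 :: "plane \<Rightarrow> real"
    and Dc :: "plane \<times> plane \<Rightarrow> plane \<times> plane"
    and T :: "plane \<Rightarrow> plane"
  assumes domains: "planar_domain \<Omega>\<^sub>0" "planar_domain \<Omega>\<^sub>0'" "planar_domain \<Omega>\<^sub>1"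
    and e: "\<forall>x\<in>\<Omega>\<^sub>0. norm (e x) = 1 \<and> snd (e x) > 0"
    and \<phi>: "inj_on \<phi> \<Omega>\<^sub>0" "\<phi> ` \<Omega>\<^sub>0 = \<Omega>\<^sub>0'" "C2_map_on \<Omega>\<^sub>0 \<phi> J" "\<forall>x\<in>\<Omega>\<^sub>0. invertible (J x)"
    and f: "\<forall>z\<in>\<Omega>\<^sub>0'. f z > 0" "C1_on \<Omega>\<^sub>0' f Df"
    and g: "\<forall>y\<in>\<Omega>\<^sub>1. g y > 0" "C1_on \<Omega>\<^sub>1 g Dg"
    and ray: "\<forall>x\<in>\<Omega>\<^sub>0. {(x, 0) + t *\<^sub>R e x | t. t > 0} \<inter> graph_over \<Omega>\<^sub>0' f = {(\<phi> x, f (\<phi> x))}"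
    and separated: "setdist (graph_over \<Omega>\<^sub>0' f) (graph_over \<Omega>\<^sub>1 g) > 0"
    and plane_above: "\<forall>y\<in>\<Omega>\<^sub>1. g y < \<beta>"
    and indices: "n\<^sub>1 > 0" "n\<^sub>2 > 0" "n\<^sub>3 > 0"
    and \<rho>\<^sub>0: "\<forall>x\<in>\<Omega>\<^sub>0. \<rho>\<^sub>0 x \<ge> 0" "set_integrable lebesgue \<Omega>\<^sub>0 \<rho>\<^sub>0"
    and \<rho>\<^sub>1: "\<forall>y\<in>\<Omega>\<^sub>1. \<rho>\<^sub>1 y \<ge> 0" "set_integrable lebesgue \<Omega>\<^sub>1 \<rho>\<^sub>1"
    and compact: "compact \<Omega>\<^sub>0" "compact \<Omega>\<^sub>1"
    and boundary: "emeasure lebesgue (frontier \<Omega>\<^sub>0) = 0"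
    and cost_C1: "C1_on (\<Omega>\<^sub>0 \<times> \<Omega>\<^sub>1) (\<lambda>(x, y). cost \<phi> f g x y) Dc"
    and cost_lipschitz: "\<exists>L. L-lipschitz_on (\<Omega>\<^sub>0 \<times> \<Omega>\<^sub>1) (\<lambda>(x, y). cost \<phi> f g x y)"
    and twist: "\<forall>x\<in>\<Omega>\<^sub>0. inj_on (\<lambda>y. fst (Dc (x, y))) \<Omega>\<^sub>1"
    and mass: "(LINT x:\<Omega>\<^sub>0|lebesgue. \<rho>\<^sub>0 x) = (LINT y:\<Omega>\<^sub>1|lebesgue. \<rho>\<^sub>1 y)"
    and \<rho>\<^sub>0_pos: "AE x\<in>\<Omega>\<^sub>0 in lebesgue. \<rho>\<^sub>0 x > 0"
    and T: "optimal_map \<Omega>\<^sub>0 \<Omega>\<^sub>1 (cost \<phi> f g) \<rho>\<^sub>0 \<rho>\<^sub>1 T"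
  shows "\<exists>\<psi> D\<psi>.
    c_concave \<Omega>\<^sub>0 \<Omega>\<^sub>1 (cost \<phi> f g) \<psi> \<and>
    (AE x\<in>\<Omega>\<^sub>0 in lebesgue. c_superdiff \<Omega>\<^sub>0 \<Omega>\<^sub>1 (cost \<phi> f g) \<psi> x = {T x}) \<and>
    (AE x\<in>\<Omega>\<^sub>0 in lebesgue. (GDERIV \<psi> x :> D\<psi> x) \<and> D\<psi> x = fst (Dc (x, T x))) \<and>
    (\<forall>\<Phi> D\<Phi> \<Psi> D\<Psi>.
       solves_double_metasurface \<Omega>\<^sub>0 \<Omega>\<^sub>0' \<Omega>\<^sub>1 e \<phi> f Df g Dg n\<^sub>1 n\<^sub>2 n\<^sub>3 \<rho>\<^sub>0 \<rho>\<^sub>1 T \<Phi> D\<Phi> \<Psi> D\<Psi> \<longrightarrow>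
       (AE x\<in>\<Omega>\<^sub>0 in lebesgue.
          fst (D\<Phi> (\<phi> x, f (\<phi> x))) =
            (mat 1 - (1 / (1 + (norm (Df (\<phi> x)))\<^sup>2)) *\<^sub>R outer_product (Df (\<phi> x)) (Df (\<phi> x))) *v
            (n\<^sub>2 *\<^sub>R (matrix_inv (transpose (J x)) *v D\<psi> x)
             + (n\<^sub>1 * snd (e x)) *\<^sub>R Df (\<phi> x) + n\<^sub>1 *\<^sub>R fst (e x)) \<and>
          fst (D\<Psi> (T x, g (T x))) =
            (mat 1 - (1 / (1 + (norm (Dg (T x)))\<^sup>2)) *\<^sub>R outer_product (Dg (T x)) (Dg (T x))) *v
            (- n\<^sub>2 *\<^sub>R (matrix_inv (transpose (J x)) *v D\<psi> x)
             + (n\<^sub>2 * (g (T x) - f (\<phi> x))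
                / sqrt ((g (T x) - f (\<phi> x))\<^sup>2 + (norm (T x - \<phi> x))\<^sup>2)) *\<^sub>R (Dg (T x) - Df (\<phi> x))
             - n\<^sub>3 *\<^sub>R Dg (T x))))"
proof -

  \<comment> \<open>Passage to the abstract transport problem\<close>
  let ?c = "cost \<phi> f g"
  let ?M = "density (lebesgue_on \<Omega>\<^sub>0) (\<lambda>x. ennreal (\<rho>\<^sub>0 x))"
  let ?N = "distr (density (lebesgue_on \<Omega>\<^sub>1) (\<lambda>y. ennreal (\<rho>\<^sub>1 y))) (restrict_space borel \<Omega>\<^sub>1) (\<lambda>y. y)"
  have tT: "transport_map \<Omega>\<^sub>0 \<Omega>\<^sub>1 \<rho>\<^sub>0 \<rho>\<^sub>1 T" using T by (simp add: optimal_map_def)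
  have leb: "\<Omega>\<^sub>0 \<in> sets lebesgue" "\<Omega>\<^sub>1 \<in> sets lebesgue"
    using compact by (auto intro: lmeasurable_compact fmeasurableD)
  have ne: "\<Omega>\<^sub>0 \<noteq> {}" "\<Omega>\<^sub>1 \<noteq> {}" using domains by (auto simp: planar_domain_def)
  interpret smooth_cost \<Omega>\<^sub>0 \<Omega>\<^sub>1 ?c "\<lambda>x y. fst (Dc (x, y))"
  proof
    show "continuous_on (\<Omega>\<^sub>0 \<times> \<Omega>\<^sub>1) (\<lambda>(x, y). fst (Dc (x, y)))"
      using cost_C1 by (auto simp: C1_on_def case_prod_unfold intro!: continuous_intros)
  qed (use compact ne C1_on_continuous[OF cost_C1] C1_on_Times_partial[OF cost_C1] in auto)
  interpret transport_problem \<Omega>\<^sub>0 \<Omega>\<^sub>1 ?c ?M ?N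
    by (rule transport_problem_density) (use leb \<rho>\<^sub>0 \<rho>\<^sub>1 mass compact in \<open>auto intro: compact_cost_axioms\<close>)
  have AE_M: "(AE x in ?M. P x) \<longleftrightarrow> (AE x\<in>\<Omega>\<^sub>0 in lebesgue. P x)" for P
    by (rule AE_density_lebesgue_on_iff[OF leb(1) \<rho>\<^sub>0(2) \<rho>\<^sub>0_pos])
  have "AE x in lebesgue. x \<notin> frontier \<Omega>\<^sub>0"
    using boundary frontier_closed by (intro AE_not_in null_setsI) auto
  \<comment> \<open>The null boundary places almost every point in the interior, where the potential
    is differentiated without reference to the domain.\<close>
  then have AE_interior: "AE x\<in>\<Omega>\<^sub>0 in lebesgue. x \<in> interior \<Omega>\<^sub>0"
    by eventually_elim (auto simp: frontier_def closure_subset[THEN subsetD])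
  have unique: "AE x in ?M. \<exists>y. contact u x = {y}" if u: "continuous_on \<Omega>\<^sub>1 u" for u
  proof -
    have "AE x in lebesgue. x \<notin> {x \<in> interior \<Omega>\<^sub>0. \<nexists>y. contact u x = {y}}"
      using negligible_multiple_contact[OF u] twist by (intro AE_not_in) (simp add: negligible_iff_null_sets)
    with AE_interior have "AE x\<in>\<Omega>\<^sub>0 in lebesgue. \<exists>y. contact u x = {y}"
      by eventually_elim blast
    then show ?thesis by (simp add: AE_M)
  qed
  obtain u where u: "continuous_on \<Omega>\<^sub>1 u"
    and max: "\<And>w. continuous_on \<Omega>\<^sub>1 w \<Longrightarrow> dual_value w \<le> dual_value u"
    and double: "\<And>y. y \<in> \<Omega>\<^sub>1 \<Longrightarrow> c_transform \<Omega>\<^sub>0 ?c (conj_fun u) y = u y"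
    using dual_maximizer by blast
  obtain S where S: "S \<in> measurable ?M ?N" "AE x in ?M. contact u x = {S x}"
    using measurable_selection[OF u unique[OF u]] by blast
  have pushS: "distr ?M ?N S = ?N" by (rule maximizer_pushforward[OF u max S])

  \<comment> \<open>Comparison of the optimal map with the contact map\<close>
  obtain y0 where y0: "y0 \<in> \<Omega>\<^sub>1" using ne by blast
  \<comment> \<open>\<open>T\<close> lands in the target only almost everywhere; the modification
    does so everywhere, as measurability into \<open>?N\<close> demands.\<close>
  define T' where "T' x = (if T x \<in> \<Omega>\<^sub>1 then T x else y0)" for x
  have T_in: "AE x\<in>\<Omega>\<^sub>0 in lebesgue. T x \<in> \<Omega>\<^sub>1" using tT by (simp add: transport_map_def)
  then have T'_eq: "AE x\<in>\<Omega>\<^sub>0 in lebesgue. T' x = T x"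
    by eventually_elim (simp add: T'_def)
  have T_meas: "T \<in> borel_measurable (lebesgue_on \<Omega>\<^sub>0)" using tT by (simp add: transport_map_def)
  have "T' \<in> borel_measurable (lebesgue_on \<Omega>\<^sub>0)"
    unfolding T'_def
    by (rule measurable_compose[OF T_meas, of "\<lambda>y. if y \<in> \<Omega>\<^sub>1 then y else y0"])
      (intro measurable_If_set measurable_ident_sets measurable_const,
        use compact(2) in \<open>auto simp: borel_compact\<close>)
  then have T': "T' \<in> measurable ?M ?N"
    by (intro measurable_M_N_I) (auto simp: T'_def y0)
  have pushT: "distr ?M ?N T' = ?N"
  proof (rule measure_eqI)
    fix E assume "E \<in> sets (distr ?M ?N T')"
    then have E: "E \<in> sets ?N" by simp
    then have EY: "E \<subseteq> \<Omega>\<^sub>1" "E \<in> sets borel"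
      using compact(2) by (auto simp: sets_restrict_space borel_compact)
    have TE: "T -` E \<inter> \<Omega>\<^sub>0 \<in> sets (lebesgue_on \<Omega>\<^sub>0)"
      using measurable_sets[OF T_meas EY(2)] by (simp add: space_restrict_space)
    have T'E: "T' -` E \<inter> \<Omega>\<^sub>0 \<in> sets (lebesgue_on \<Omega>\<^sub>0)"
      using measurable_sets[OF T' E] by (simp add: space_restrict_space)
    have "emeasure (distr ?M ?N T') E = emeasure ?M (T' -` E \<inter> \<Omega>\<^sub>0)"
      using emeasure_distr[OF T' E] by (simp add: space_restrict_space)
    also have "\<dots> = emeasure ?M (T -` E \<inter> \<Omega>\<^sub>0)"
    proof (rule emeasure_eq_AE)
      have "AE x in ?M. T' x = T x" using T'_eq by (simp add: AE_M)
      then show "AE x in ?M. x \<in> T' -` E \<inter> \<Omega>\<^sub>0 \<longleftrightarrow> x \<in> T -` E \<inter> \<Omega>\<^sub>0"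
        by eventually_elim simp
    qed (use TE T'E in simp_all)
    also have "\<dots> = ennreal (LINT x:T -` E \<inter> \<Omega>\<^sub>0|lebesgue. \<rho>\<^sub>0 x)"
      using TE leb by (intro emeasure_density_lebesgue_on \<rho>\<^sub>0) (auto simp: sets_restrict_space_iff)
    also have "T -` E \<inter> \<Omega>\<^sub>0 = {x \<in> \<Omega>\<^sub>0. T x \<in> E}" by auto
    also have "(LINT x:{x \<in> \<Omega>\<^sub>0. T x \<in> E}|lebesgue. \<rho>\<^sub>0 x) = (LINT y:E|lebesgue. \<rho>\<^sub>1 y)"
      using tT EY by (simp add: transport_map_def)
    also have "ennreal \<dots> = emeasure ?N E"
      using EY by (simp add: emeasure_distr_density_lebesgue_on leb \<rho>\<^sub>1)
    finally show "emeasure (distr ?M ?N T') E = emeasure ?N E" .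
  qed simp
  \<comment> \<open>This makes \<open>S\<close> an admissible competitor in the Monge
    problem.\<close>
  have transportS: "transport_map \<Omega>\<^sub>0 \<Omega>\<^sub>1 \<rho>\<^sub>0 \<rho>\<^sub>1 S"
    unfolding transport_map_def
  proof (intro conjI ballI impI)
    show "S \<in> borel_measurable (lebesgue_on \<Omega>\<^sub>0)"
      using measurable_M_N_borel[OF S(1)] by simp
    then have S_meas: "{x \<in> \<Omega>\<^sub>0. S x \<in> E} \<in> sets lebesgue" if "E \<in> sets borel" for E
    proof -
      have "S -` E \<inter> \<Omega>\<^sub>0 \<in> sets lebesgue"
        using measurable_sets[OF \<open>S \<in> borel_measurable (lebesgue_on \<Omega>\<^sub>0)\<close> that] leb
        by (simp add: space_restrict_space sets_restrict_space_iff)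
      moreover have "{x \<in> \<Omega>\<^sub>0. S x \<in> E} = S -` E \<inter> \<Omega>\<^sub>0" by auto
      ultimately show ?thesis by simp
    qed
    show "AE x\<in>\<Omega>\<^sub>0 in lebesgue. S x \<in> \<Omega>\<^sub>1"
      using M_N_range[OF S(1)] by simp
    fix E assume E: "E \<in> sets borel" "E \<subseteq> \<Omega>\<^sub>1"
    then have EN: "E \<in> sets ?N" by (auto simp: sets_restrict_space)
    have "ennreal (LINT x:{x \<in> \<Omega>\<^sub>0. S x \<in> E}|lebesgue. \<rho>\<^sub>0 x) = emeasure ?M {x \<in> \<Omega>\<^sub>0. S x \<in> E}"
      using S_meas[OF E(1)] leb by (intro emeasure_density_lebesgue_on[symmetric] \<rho>\<^sub>0) auto
    also have "\<dots> = emeasure ?M (S -` E \<inter> space ?M)"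
      by (rule arg_cong[where f = "emeasure ?M"]) (auto simp: space_restrict_space)
    also have "emeasure ?M (S -` E \<inter> space ?M) = emeasure ?N E"
      using emeasure_distr[OF S(1) EN] unfolding pushS by simp
    also have "\<dots> = ennreal (LINT y:E|lebesgue. \<rho>\<^sub>1 y)"
      by (simp add: emeasure_distr_density_lebesgue_on leb \<rho>\<^sub>1 E)
    finally show "(LINT x:{x \<in> \<Omega>\<^sub>0. S x \<in> E}|lebesgue. \<rho>\<^sub>0 x) = (LINT y:E|lebesgue. \<rho>\<^sub>1 y)"
      by (subst (asm) ennreal_inj)
        (use E in \<open>auto intro!: set_integral_nonneg_subset[OF \<rho>\<^sub>0(1)] set_integral_nonneg_subset[OF \<rho>\<^sub>1(1)]\<close>)
  qed
  have cost_integral: "(LINT x:\<Omega>\<^sub>0|lebesgue. ?c x (s x) * \<rho>\<^sub>0 x) = (\<integral>x. ?c x (s x) \<partial>?M)"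
    if s: "s \<in> measurable ?M ?N" for s
    using leb \<rho>\<^sub>0 borel_measurable_integrable[OF integrable_cost[OF s]]
    by (intro set_integral_eq_integral_density) simp_all
  have "(\<integral>x. ?c x (T' x) \<partial>?M) = (LINT x:\<Omega>\<^sub>0|lebesgue. ?c x (T' x) * \<rho>\<^sub>0 x)"
    by (rule cost_integral[OF T', symmetric])
  also have "\<dots> = (LINT x:\<Omega>\<^sub>0|lebesgue. ?c x (T x) * \<rho>\<^sub>0 x)"
  proof -
    let ?F = "\<lambda>s x. indicator \<Omega>\<^sub>0 x *\<^sub>R (?c x (s x) * \<rho>\<^sub>0 x)"
    have eq: "AE x in lebesgue. ?F T' x = ?F T x"
      using T'_eq by eventually_elim (auto simp: indicator_def)
    have "(\<lambda>x. ?c x (T' x) * \<rho>\<^sub>0 x) \<in> borel_measurable (lebesgue_on \<Omega>\<^sub>0)"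
      using borel_measurable_integrable[OF integrable_cost[OF T']]
        set_integrable_imp_integrable_lebesgue_on[OF leb(1) \<rho>\<^sub>0(2)]
      by (intro borel_measurable_times) (simp_all add: borel_measurable_integrable)
    then have F: "?F T' \<in> borel_measurable lebesgue"
      using leb by (simp add: borel_measurable_restrict_space_iff mult.commute)
    show ?thesis
      unfolding set_lebesgue_integral_def
      \<comment> \<open>Completeness of Lebesgue measure transfers measurability of the integrand
        from \<open>T'\<close> to \<open>T\<close>.\<close>
      by (rule integral_cong_AE[OF F borel_measurable_AE[OF F eq] eq])
  qed
  also have "\<dots> \<le> (LINT x:\<Omega>\<^sub>0|lebesgue. ?c x (S x) * \<rho>\<^sub>0 x)"
    using T transportS by (simp add: optimal_map_def)
  also have "\<dots> = (\<integral>x. ?c x (S x) \<partial>?M)"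
    by (rule cost_integral[OF S(1)])
  finally have le: "(\<integral>x. ?c x (T' x) \<partial>?M) \<le> (\<integral>x. ?c x (S x) \<partial>?M)" .
  have "AE x in ?M. S x \<in> contact u x" using S(2) by eventually_elim simp
  from optimal_map_in_contact[OF u S(1) pushS this T' pushT le]
  have "AE x in ?M. T' x \<in> contact u x" .
  with S(2) have "AE x in ?M. contact u x = {T' x}" by eventually_elim auto
  then have contact_T: "AE x\<in>\<Omega>\<^sub>0 in lebesgue. contact u x = {T x}"
    using T'_eq unfolding AE_M by eventually_elim auto
  \<comment> \<open>With \<open>?D\<close> taken to be the cost gradient at \<open>T x\<close>, what
    remains is that the potential is differentiable with this gradient.\<close>
  let ?\<psi> = "conj_fun u" and ?D = "\<lambda>x. fst (Dc (x, T x))"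
  show ?thesis
  proof (rule exI[of _ ?\<psi>], rule exI[of _ ?D], intro conjI allI impI)
    show "c_concave \<Omega>\<^sub>0 \<Omega>\<^sub>1 ?c ?\<psi>" by (rule c_concave_conj_fun[OF u])
    show "AE x\<in>\<Omega>\<^sub>0 in lebesgue. c_superdiff \<Omega>\<^sub>0 \<Omega>\<^sub>1 ?c ?\<psi> x = {T x}"
      using contact_T by (simp add: c_superdiff_eq_contact[OF double])
    show "AE x\<in>\<Omega>\<^sub>0 in lebesgue. (GDERIV ?\<psi> x :> ?D x) \<and> ?D x = fst (Dc (x, T x))"
      using contact_T AE_interior by eventually_elim (use conj_fun_has_gradient[OF u] in blast)

    \<comment> \<open>Phase formulas\<close>
    fix \<Phi> D\<Phi> \<Psi> D\<Psi>
    assume sol: "solves_double_metasurface \<Omega>\<^sub>0 \<Omega>\<^sub>0' \<Omega>\<^sub>1 e \<phi> f Df g Dg n\<^sub>1 n\<^sub>2 n\<^sub>3 \<rho>\<^sub>0 \<rho>\<^sub>1 T \<Phi> D\<Phi> \<Psi> D\<Psi>"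
    then have "AE x\<in>\<Omega>\<^sub>0 in lebesgue. \<exists>l l'.
        n\<^sub>1 *\<^sub>R e x - n\<^sub>2 *\<^sub>R refracted_dir \<phi> f g T x
          = l *\<^sub>R (- Df (\<phi> x), 1) + D\<Phi> (\<phi> x, f (\<phi> x)) \<and>
        n\<^sub>2 *\<^sub>R refracted_dir \<phi> f g T x - n\<^sub>3 *\<^sub>R (0, 1)
          = l' *\<^sub>R (- Dg (T x), 1) + D\<Psi> (T x, g (T x))"
      by (simp add: solves_double_metasurface_def)
    then show "AE x\<in>\<Omega>\<^sub>0 in lebesgue.
          fst (D\<Phi> (\<phi> x, f (\<phi> x))) =
            (mat 1 - (1 / (1 + (norm (Df (\<phi> x)))\<^sup>2)) *\<^sub>R outer_product (Df (\<phi> x)) (Df (\<phi> x))) *v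
            (n\<^sub>2 *\<^sub>R (matrix_inv (transpose (J x)) *v ?D x)
             + (n\<^sub>1 * snd (e x)) *\<^sub>R Df (\<phi> x) + n\<^sub>1 *\<^sub>R fst (e x)) \<and>
          fst (D\<Psi> (T x, g (T x))) =
            (mat 1 - (1 / (1 + (norm (Dg (T x)))\<^sup>2)) *\<^sub>R outer_product (Dg (T x)) (Dg (T x))) *v
            (- n\<^sub>2 *\<^sub>R (matrix_inv (transpose (J x)) *v ?D x)
             + (n\<^sub>2 * (g (T x) - f (\<phi> x))
                / sqrt ((g (T x) - f (\<phi> x))\<^sup>2 + (norm (T x - \<phi> x))\<^sup>2)) *\<^sub>R (Dg (T x) - Df (\<phi> x))
             - n\<^sub>3 *\<^sub>R Dg (T x))"
      using AE_interior T_in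
    proof eventually_elim
      case (elim x)
      show ?case
      proof (rule impI)
        assume x: "x \<in> \<Omega>\<^sub>0"
        then obtain l l' where
          snell1: "n\<^sub>1 *\<^sub>R e x - n\<^sub>2 *\<^sub>R refracted_dir \<phi> f g T x = l *\<^sub>R (- Df (\<phi> x), 1) + D\<Phi> (\<phi> x, f (\<phi> x))" and
          snell2: "n\<^sub>2 *\<^sub>R refracted_dir \<phi> f g T x - n\<^sub>3 *\<^sub>R (0, 1) = l' *\<^sub>R (- Dg (T x), 1) + D\<Psi> (T x, g (T x))"
          using elim(1) by blast
        have xi: "x \<in> interior \<Omega>\<^sub>0" and Tx: "T x \<in> \<Omega>\<^sub>1" using elim x by auto
        have tang: "D\<Phi> (\<phi> x, f (\<phi> x)) \<bullet> (- Df (\<phi> x), 1) = 0" "D\<Psi> (T x, g (T x)) \<bullet> (- Dg (T x), 1) = 0"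
          using sol \<phi>(2) x Tx by (auto simp: solves_double_metasurface_def tangential_def)
        define r where "r = ?c x (T x)"
        have r: "r = sqrt ((norm (T x - \<phi> x))\<^sup>2 + (g (T x) - f (\<phi> x))\<^sup>2)"
          "r = sqrt ((g (T x) - f (\<phi> x))\<^sup>2 + (norm (T x - \<phi> x))\<^sup>2)"
          by (simp_all add: r_def cost_def norm_minus_commute add.commute)
        have "setdist (graph_over \<Omega>\<^sub>0' f) (graph_over \<Omega>\<^sub>1 g) \<le> r"
          unfolding r_def cost_eq_dist using x Tx \<phi>(2)
          by (intro setdist_le_dist) (auto simp: graph_over_def)
        then have "0 < r" using separated by linarith
        \<comment> \<open>By \<open>cost_gradient\<close>, the transposed Jacobian maps
          \<open>W\<close> to the gradient of the potential, so \<open>W\<close> is the explicit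
          form of the inverse term in both formulas.\<close>
        define W where "W = (1 / r) *\<^sub>R (\<phi> x - T x - (g (T x) - f (\<phi> x)) *\<^sub>R Df (\<phi> x))"
        have "?D x = transpose (J x) *v W"
          unfolding W_def r_def
          by (rule cost_gradient[OF \<phi>(3) _ xi])
            (use f \<phi>(2) \<open>0 < r\<close> deriv[OF x Tx] in \<open>auto simp: r_def\<close>)
        moreover have "invertible (transpose (J x))"
          using \<phi>(4) x by (simp add: transpose_invertible)
        ultimately have W: "matrix_inv (transpose (J x)) *v ?D x = W"
          by (simp only: matrix_inv_mult_vector)
        have dir: "refracted_dir \<phi> f g T x = ((1 / r) *\<^sub>R (T x - \<phi> x), (g (T x) - f (\<phi> x)) / r)"
          by (simp add: refracted_dir_def r(1)[symmetric])
        \<comment> \<open>The instances are the horizontal and vertical parts of the left sides of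
          the two Snell equations.\<close>
        note 1 = tangential_gradient_component[OF _ tang(1), of
            "n\<^sub>1 *\<^sub>R fst (e x) - (n\<^sub>2 / r) *\<^sub>R (T x - \<phi> x)" "n\<^sub>1 * snd (e x) - n\<^sub>2 * (g (T x) - f (\<phi> x)) / r" l]
        note 2 = tangential_gradient_component[OF _ tang(2), of
            "(n\<^sub>2 / r) *\<^sub>R (T x - \<phi> x)" "n\<^sub>2 * (g (T x) - f (\<phi> x)) / r - n\<^sub>3" l']
        show "fst (D\<Phi> (\<phi> x, f (\<phi> x))) =
            (mat 1 - (1 / (1 + (norm (Df (\<phi> x)))\<^sup>2)) *\<^sub>R outer_product (Df (\<phi> x)) (Df (\<phi> x))) *v
            (n\<^sub>2 *\<^sub>R (matrix_inv (transpose (J x)) *v ?D x)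
             + (n\<^sub>1 * snd (e x)) *\<^sub>R Df (\<phi> x) + n\<^sub>1 *\<^sub>R fst (e x)) \<and>
          fst (D\<Psi> (T x, g (T x))) =
            (mat 1 - (1 / (1 + (norm (Dg (T x)))\<^sup>2)) *\<^sub>R outer_product (Dg (T x)) (Dg (T x))) *v
            (- n\<^sub>2 *\<^sub>R (matrix_inv (transpose (J x)) *v ?D x)
             + (n\<^sub>2 * (g (T x) - f (\<phi> x))
                / sqrt ((g (T x) - f (\<phi> x))\<^sup>2 + (norm (T x - \<phi> x))\<^sup>2)) *\<^sub>R (Dg (T x) - Df (\<phi> x))
             - n\<^sub>3 *\<^sub>R Dg (T x))"
          unfolding W r(2)[symmetric]
        proof (intro conjI)
          have "(n\<^sub>1 *\<^sub>R fst (e x) - (n\<^sub>2 / r) *\<^sub>R (T x - \<phi> x)) + (n\<^sub>1 * snd (e x) - n\<^sub>2 * (g (T x) - f (\<phi> x)) / r) *\<^sub>R Df (\<phi> x)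
              = n\<^sub>2 *\<^sub>R W + (n\<^sub>1 * snd (e x)) *\<^sub>R Df (\<phi> x) + n\<^sub>1 *\<^sub>R fst (e x)"
            by (simp add: W_def algebra_simps diff_divide_distrib)
          with 1 snell1 show "fst (D\<Phi> (\<phi> x, f (\<phi> x))) =
            (mat 1 - (1 / (1 + (norm (Df (\<phi> x)))\<^sup>2)) *\<^sub>R outer_product (Df (\<phi> x)) (Df (\<phi> x))) *v
            (n\<^sub>2 *\<^sub>R W + (n\<^sub>1 * snd (e x)) *\<^sub>R Df (\<phi> x) + n\<^sub>1 *\<^sub>R fst (e x))"
            by (simp add: dir prod_eq_iff)
          \<comment> \<open>The term with \<open>Dg (T x) - Df (\<phi> x)\<close> removes the
            contribution of \<open>Df\<close> contained in \<open>W\<close> and supplies that of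
            \<open>Dg\<close>.\<close>
          have "(n\<^sub>2 / r) *\<^sub>R (T x - \<phi> x) + (n\<^sub>2 * (g (T x) - f (\<phi> x)) / r - n\<^sub>3) *\<^sub>R Dg (T x)
              = - n\<^sub>2 *\<^sub>R W + (n\<^sub>2 * (g (T x) - f (\<phi> x)) / r) *\<^sub>R (Dg (T x) - Df (\<phi> x)) - n\<^sub>3 *\<^sub>R Dg (T x)"
            by (simp add: W_def algebra_simps diff_divide_distrib)
          with 2 snell2 show "fst (D\<Psi> (T x, g (T x))) =
            (mat 1 - (1 / (1 + (norm (Dg (T x)))\<^sup>2)) *\<^sub>R outer_product (Dg (T x)) (Dg (T x))) *v
            (- n\<^sub>2 *\<^sub>R W + (n\<^sub>2 * (g (T x) - f (\<phi> x)) / r) *\<^sub>R (Dg (T x) - Df (\<phi> x)) - n\<^sub>3 *\<^sub>R Dg (T x))"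
            by (simp add: dir prod_eq_iff)
        qed
      qed
    qed
  qed
qed

end
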